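(* Fix integers $N\ge1$ and $K\ge0$, gauge couplings $g,g'$, a hypercharge $Y$ and a scalar potential $V(\Phi,s)$, and let $\mathcal{L}_4$ and $\mathcal{L}_1$ be the corresponding NHDM+KS Lagrangians in $4$ and $1$ spacetime dimensions, respectively. To find all scalar, variational Lie point symmetries of $\mathcal{L}_4$ it is sufficient to consider $\mathcal{L}_1$, because such symmetries are exactly the same for the two theories: a generator $X=\sum_i\eta_i(\phi_1,\dots,\phi_{4N+K})\,\partial_{\phi_i}$ is a variational symmetry of $\mathcal{L}_4$ if and only if it is a variational symmetry of $\mathcal{L}_1$.
   Context: **NHDM+KS Lagrangian** ($N$ Higgs doublets and $K$ real scalar gauge singlets; $K=0$ means no singlets) in $d$ spacetime dimensions with coordinates $x_0,\dots,x_{d-1}$ and Minkowski metric: $$\mathcal{L}_d=\sum_{\mu=0}^{d-1}\Big(\sum_{n=1}^N(D_\mu\Phi_n)^\dagger D^\mu\Phi_n+\sum_{m=1}^K\tfrac12\,\partial_\mu s_m\,\partial^\mu s_m\Big)-V(\Phi,s)-\sum_{\mu,\nu=0}^{d-1}\Big(\tfrac14W^a_{\mu\nu}W^{a\mu\nu}+\tfrac14B_{\mu\nu}B^{\mu\nu}\Big),$$ where $\Phi=(\Phi_1,\dots,\Phi_N)$, $s=(s_1,\dots,s_K)$, the index $a$ is summed over $1,2,3$, and $$D_\mu=\partial_\mu+ig\tfrac{\sigma^a}{2}W^a_\mu+ig'YB_\mu,\quad W^a_{\mu\nu}=\partial_\mu W^a_\nu-\partial_\nu W^a_\mu+g\,\epsilon^{abc}W^b_\mu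 W^c_\nu,\quad B_{\mu\nu}=\partial_\mu B_\nu-\partial_\nu B_\mu,$$ $$\Phi_j=\frac1{\sqrt2}\begin{pmatrix}\phi_{4(j-1)+1}+i\phi_{4(j-1)+2}\\ \phi_{4(j-1)+3}+i\phi_{4(j-1)+4}\end{pmatrix},$$ with $\sigma^a$ the Pauli matrices. All $\phi_i$, $s_m$, $W^a_\mu$, $B_\mu$ are real fields (dependent variables). The potential $V$ is a real polynomial in the (undifferentiated) scalar fields; the same $V,g,g',Y$ are used for both dimensions. We write $\phi_{4N+k}:=s_k$ for $1\le k\le K$. The dependent variables of $\mathcal{L}_d$ are the $4N+K$ scalars and the $4d$ gauge field components $W^a_\mu,B_\mu$. **Scalar generators.** Scalar symmetries are generated by vector fields $X=\sum_{i=1}^{4N+K}\eta_i\,\partial_{\phi_i}$ with smooth $\eta_i=\eta_i(\phi_1,\dots,\phi_{4N+K})$; spacetime variables and gauge fields are not transformed. In dimension $d$ the first prolongation of $X$ is $$\operatorname{pr}^{(1)}X_d=\sum_i\eta_i\,\partial_{\phi_i}+\sum_{\mu=0}^{d-1}\sum_{i,j}\frac{\partial\phi_j}{\partial x_\mu}\frac{\partial\eta_i}{\partial\phi_j}\frac{\partial}{\partial(\partial\phi_i/\partial x_\mu)}.$$ **Variational symmetry.** $X$ is a variational symmetry of $\mathcal{L}_d$ if $\operatorname{pr}^{(1)}X_d(\mathcal{L}_d)=\sum_{\mu=0}^{d-1}\frac{d\beta^\mu}{dx^\mu}$ identically (without assuming any field equations), for some local functions $\beta^\mu$ of the spacetime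 variables, the fields and finitely many derivatives of the fields; here $d/dx^\mu$ is the total derivative. The case $\beta^\mu=0$ for all $\mu$ (strict variational symmetry) is included. *)

theory Defs
  imports "HOL-Analysis.Analysis" "HOL-Library.Multiset"
begin

section \<open>Smooth functions of finitely many real coordinates\<close>

text \<open>Points are assignments of a real number to each coordinate of type \<open>'c\<close>; this lets the number
  of coordinates vary without varying the type.\<close>

definition partial_deriv :: "'c \<Rightarrow> (('c \<Rightarrow> real) \<Rightarrow> real) \<Rightarrow> ('c \<Rightarrow> real) \<Rightarrow> real" where
  "partial_deriv c f z = deriv (\<lambda>t. f (z(c := t))) (z c)"

definition depends_only_on :: "'c set \<Rightarrow> (('c \<Rightarrow> real) \<Rightarrow> real) \<Rightarrow> bool" where
  "depends_only_on S f \<longleftrightarrow> (\<forall>z w. (\<forall>c\<in>S. z c = w c) \<longrightarrow> f z = f w)"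

text \<open>All iterated partial derivatives exist and are continuous. Continuity refers to the product
  topology; for a function that depends on a finite set \<open>S\<close> of coordinates only, this is ordinary
  continuity of a function on \<open>\<real>\<^sup>S\<close>, so that \<open>smooth_function_of S\<close> describes \<open>C\<^sup>\<infinity>(\<real>\<^sup>S)\<close>.\<close>

definition smooth_function_of :: "'c set \<Rightarrow> (('c \<Rightarrow> real) \<Rightarrow> real) \<Rightarrow> bool" where
  "smooth_function_of S f \<longleftrightarrow> depends_only_on S f \<and>
     (\<forall>cs. continuous_on UNIV (foldr partial_deriv cs f) \<and>
       (\<forall>c z. (\<lambda>t. foldr partial_deriv cs f (z(c := t))) field_differentiable at (z c)))"

definition polynomial_function_of :: "'c set \<Rightarrow> (('c \<Rightarrow> real) \<Rightarrow> real) \<Rightarrow> bool" where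
  "polynomial_function_of S p \<longleftrightarrow>
     (\<exists>(M :: ('c \<Rightarrow> nat) set) a. finite M \<and> p = (\<lambda>x. \<Sum>m\<in>M. a m * (\<Prod>c\<in>S. x c ^ m c)))"

section \<open>Jet coordinates\<close>

text \<open>\<open>Scalar i\<close> is \<open>\<phi>\<^sub>i\<close> (\<open>1 \<le> i \<le> 4N + K\<close>, with \<open>s\<^sub>m = \<phi>\<^bsub>4N+m\<^esub>\<close>), \<open>WField a \<mu>\<close> is \<open>W\<^sup>a\<^sub>\<mu>\<close> and
  \<open>BField \<mu>\<close> is \<open>B\<^sub>\<mu>\<close> (lower Lorentz index).\<close>

datatype field_var = Scalar nat | WField nat nat | BField nat

text \<open>\<open>Jet u J\<close> is the derivative of the dependent variable \<open>u\<close> with respect to the spacetime variables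
  in the multiset \<open>J\<close>; derivatives commute, hence multisets. \<open>Jet u {#}\<close> is \<open>u\<close> itself.\<close>

datatype jet_coord = Spacetime nat | Jet field_var "nat multiset"

type_synonym jet = "jet_coord \<Rightarrow> real"

definition scalar_indices :: "nat \<Rightarrow> nat \<Rightarrow> nat set" where
  "scalar_indices N K = {1..4 * N + K}"

definition dependent_vars :: "nat \<Rightarrow> nat \<Rightarrow> nat \<Rightarrow> field_var set" where
  "dependent_vars N K d =
     Scalar ` scalar_indices N K \<union> {WField a \<mu> |a \<mu>. a \<in> {1..3} \<and> \<mu> < d} \<union> BField ` {..<d}"

definition jet_coords :: "nat \<Rightarrow> nat \<Rightarrow> nat \<Rightarrow> jet_coord set" where
  "jet_coords N K d =
     Spacetime ` {..<d} \<union> {Jet u J |u J. u \<in> dependent_vars N K d \<and> set_mset J \<subseteq> {..<d}}"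

definition local_function :: "nat \<Rightarrow> nat \<Rightarrow> nat \<Rightarrow> (jet \<Rightarrow> real) \<Rightarrow> bool" where
  "local_function N K d f \<longleftrightarrow> (\<exists>S. finite S \<and> S \<subseteq> jet_coords N K d \<and> smooth_function_of S f)"

text \<open>The range of summation consists of the jet coordinates that contribute at \<open>z\<close>; it is finite when
  \<open>f\<close> depends on finitely many coordinates (lemma \<open>finite_partial_deriv_support\<close>).\<close>

definition total_deriv :: "nat \<Rightarrow> (jet \<Rightarrow> real) \<Rightarrow> jet \<Rightarrow> real" where
  "total_deriv \<mu> f z = partial_deriv (Spacetime \<mu>) f z +
     (\<Sum>(u, J) \<in> {(u, J). partial_deriv (Jet u J) f z \<noteq> 0}.
        z (Jet u (add_mset \<mu> J)) * partial_deriv (Jet u J) f z)"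

lemma finite_partial_deriv_support:
  assumes "finite S" "depends_only_on S f"
  shows "finite {(u, J). partial_deriv (Jet u J) f z \<noteq> 0}"
proof -
  have "partial_deriv c f z = 0" if "c \<notin> S" for c
  proof -
    have "(\<lambda>t. f (z(c := t))) = (\<lambda>t. f z)"
      using assms(2) that unfolding depends_only_on_def by (metis fun_upd_apply)
    then show ?thesis by (simp add: partial_deriv_def)
  qed
  then have "(\<lambda>(u, J). Jet u J) ` {(u, J). partial_deriv (Jet u J) f z \<noteq> 0} \<subseteq> S" by auto
  moreover have "inj (\<lambda>(u, J). Jet u J)" by (auto simp: inj_on_def)
  ultimately show ?thesis
    using assms(1) by (meson finite_imageD finite_subset inj_on_subset subset_UNIV)
qed

abbreviation field_value :: "jet \<Rightarrow> field_var \<Rightarrow> real" where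
  "field_value z u \<equiv> z (Jet u {#})"

abbreviation field_deriv :: "nat \<Rightarrow> jet \<Rightarrow> field_var \<Rightarrow> real" where
  "field_deriv \<mu> z u \<equiv> z (Jet u {#\<mu>#})"

section \<open>The Lagrangian\<close>

definition metric :: "nat \<Rightarrow> nat \<Rightarrow> real" where
  "metric \<mu> \<nu> = (if \<mu> = \<nu> then (if \<mu> = 0 then 1 else -1) else 0)"

definition raise_index :: "nat \<Rightarrow> (nat \<Rightarrow> 'v::real_vector) \<Rightarrow> nat \<Rightarrow> 'v" where
  "raise_index d v \<mu> = (\<Sum>\<nu><d. metric \<mu> \<nu> *\<^sub>R v \<nu>)"

definition raise_indices :: "nat \<Rightarrow> (nat \<Rightarrow> nat \<Rightarrow> real) \<Rightarrow> nat \<Rightarrow> nat \<Rightarrow> real" where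
  "raise_indices d F \<mu> \<nu> = raise_index d (\<lambda>\<rho>. raise_index d (F \<rho>) \<nu>) \<mu>"

definition pauli :: "nat \<Rightarrow> complex^2^2" where
  "pauli a =
     (if a = 1 then vector [vector [0, 1], vector [1, 0]]
      else if a = 2 then vector [vector [0, - \<i>], vector [\<i>, 0]]
      else vector [vector [1, 0], vector [0, -1]])"

definition levi_civita :: "nat \<Rightarrow> nat \<Rightarrow> nat \<Rightarrow> real" where
  "levi_civita a b c =
     (if (a, b, c) \<in> {(1, 2, 3), (2, 3, 1), (3, 1, 2)} then 1
      else if (a, b, c) \<in> {(1, 3, 2), (3, 2, 1), (2, 1, 3)} then -1
      else 0)"

definition hermitian_product :: "complex^2 \<Rightarrow> complex^2 \<Rightarrow> complex" where
  "hermitian_product v w = (\<Sum>k\<in>UNIV. cnj (v $ k) * w $ k)"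

text \<open>Applied to the values of the scalars this is \<open>\<Phi>\<^sub>j\<close>; by linearity, applied to their derivatives it
  is the derivative of \<open>\<Phi>\<^sub>j\<close>.\<close>

definition doublet :: "(nat \<Rightarrow> real) \<Rightarrow> nat \<Rightarrow> complex^2" where
  "doublet \<phi> j = (1 / sqrt 2) *\<^sub>R vector
     [Complex (\<phi> (4 * (j - 1) + 1)) (\<phi> (4 * (j - 1) + 2)),
      Complex (\<phi> (4 * (j - 1) + 3)) (\<phi> (4 * (j - 1) + 4))]"

definition cov_deriv :: "real \<Rightarrow> real \<Rightarrow> real \<Rightarrow> jet \<Rightarrow> nat \<Rightarrow> nat \<Rightarrow> complex^2" where
  "cov_deriv g g' Y z n \<mu> =
     doublet (\<lambda>i. field_deriv \<mu> z (Scalar i)) n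
     + (\<Sum>a=1..3. (\<i> * g * field_value z (WField a \<mu>) / 2) *s
          (pauli a *v doublet (\<lambda>i. field_value z (Scalar i)) n))
     + (\<i> * g' * Y * field_value z (BField \<mu>)) *s doublet (\<lambda>i. field_value z (Scalar i)) n"

definition W_strength :: "real \<Rightarrow> jet \<Rightarrow> nat \<Rightarrow> nat \<Rightarrow> nat \<Rightarrow> real" where
  "W_strength g z a \<mu> \<nu> =
     field_deriv \<mu> z (WField a \<nu>) - field_deriv \<nu> z (WField a \<mu>)
     + g * (\<Sum>b=1..3. \<Sum>c=1..3.
         levi_civita a b c * field_value z (WField b \<mu>) * field_value z (WField c \<nu>))"

definition B_strength :: "jet \<Rightarrow> nat \<Rightarrow> nat \<Rightarrow> real" where
  "B_strength z \<mu> \<nu> = field_deriv \<mu> z (BField \<nu>) - field_deriv \<nu> z (BField \<mu>)"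

text \<open>The real part only serves to make the type real: see lemma \<open>kinetic_term_real\<close> below.\<close>

definition lagrangian ::
    "nat \<Rightarrow> nat \<Rightarrow> real \<Rightarrow> real \<Rightarrow> real \<Rightarrow> ((nat \<Rightarrow> real) \<Rightarrow> real) \<Rightarrow> nat \<Rightarrow> jet \<Rightarrow> real" where
  "lagrangian N K g g' Y V d z =
     (\<Sum>\<mu><d.
        (\<Sum>n=1..N. Re (hermitian_product (cov_deriv g g' Y z n \<mu>)
                         (raise_index d (cov_deriv g g' Y z n) \<mu>)))
        + (\<Sum>m=1..K. 1/2 * field_deriv \<mu> z (Scalar (4 * N + m)) *
             raise_index d (\<lambda>\<nu>. field_deriv \<nu> z (Scalar (4 * N + m))) \<mu>))
     - V (\<lambda>i. field_value z (Scalar i))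
     - (\<Sum>\<mu><d. \<Sum>\<nu><d.
          1/4 * (\<Sum>a=1..3. W_strength g z a \<mu> \<nu> * raise_indices d (W_strength g z a) \<mu> \<nu>)
          + 1/4 * (B_strength z \<mu> \<nu> * raise_indices d (B_strength z) \<mu> \<nu>))"

lemma raise_index_diag: "\<mu> < d \<Longrightarrow> raise_index d v \<mu> = metric \<mu> \<mu> *\<^sub>R v \<mu>"
proof -
  assume "\<mu> < d"
  have "raise_index d v \<mu> = (\<Sum>\<nu><d. if \<mu> = \<nu> then metric \<mu> \<nu> *\<^sub>R v \<nu> else 0)"
    unfolding raise_index_def by (rule sum.cong) (auto simp: metric_def)
  with \<open>\<mu> < d\<close> show ?thesis by simp
qed

lemma kinetic_term_real:
  "\<mu> < d \<Longrightarrow> Im (hermitian_product (v \<mu>) (raise_index d v \<mu>)) = 0"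
  by (simp add: raise_index_diag hermitian_product_def algebra_simps)

section \<open>Scalar generators and variational symmetries\<close>

text \<open>A family \<open>\<eta>\<close> represents the vector field with components \<open>\<eta> i\<close> for \<open>i\<close> in \<open>scalar_indices N K\<close>;
  its values at other indices are irrelevant.\<close>

definition scalar_generator :: "nat \<Rightarrow> nat \<Rightarrow> (nat \<Rightarrow> (nat \<Rightarrow> real) \<Rightarrow> real) \<Rightarrow> bool" where
  "scalar_generator N K \<eta> \<longleftrightarrow>
     (\<forall>i\<in>scalar_indices N K. smooth_function_of (scalar_indices N K) (\<eta> i))"

definition prolongation ::
    "nat \<Rightarrow> nat \<Rightarrow> nat \<Rightarrow> (nat \<Rightarrow> (nat \<Rightarrow> real) \<Rightarrow> real) \<Rightarrow> (jet \<Rightarrow> real) \<Rightarrow> jet \<Rightarrow> real" where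
  "prolongation N K d \<eta> L z =
     (let \<phi> = (\<lambda>i. field_value z (Scalar i)) in
       (\<Sum>i\<in>scalar_indices N K. \<eta> i \<phi> * partial_deriv (Jet (Scalar i) {#}) L z)
       + (\<Sum>\<mu><d. \<Sum>i\<in>scalar_indices N K. \<Sum>j\<in>scalar_indices N K.
            field_deriv \<mu> z (Scalar j) * partial_deriv j (\<eta> i) \<phi> *
            partial_deriv (Jet (Scalar i) {#\<mu>#}) L z))"

definition variational_symmetry ::
    "nat \<Rightarrow> nat \<Rightarrow> nat \<Rightarrow> (jet \<Rightarrow> real) \<Rightarrow> (nat \<Rightarrow> (nat \<Rightarrow> real) \<Rightarrow> real) \<Rightarrow> bool" where
  "variational_symmetry N K d L \<eta> \<longleftrightarrow>
     (\<exists>\<beta>. (\<forall>\<mu><d. local_function N K d (\<beta> \<mu>)) \<and>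
          (\<forall>z. prolongation N K d \<eta> L z = (\<Sum>\<mu><d. total_deriv \<mu> (\<beta> \<mu>) z)))"

end

theory Submission imports Defs
begin

text \<open>
  The prolongation of a scalar generator applied to the Lagrangian is
  \<open>\<Sum>\<^sub>\<mu> g\<^sub>\<mu>\<^sub>\<mu> Q(\<phi>; \<partial>\<^sub>\<mu>\<phi>, W\<^sub>\<mu>, B\<^sub>\<mu>) - P(\<phi>)\<close>, where neither \<open>Q\<close> nor \<open>P\<close> depends on the
  dimension and \<open>Q\<close> is homogeneous of degree 2 in its last three arguments. In every dimension
  \<open>d \<ge> 1\<close> this is a total divergence iff \<open>Q = 0\<close> and \<open>P\<close> is constant; the constant \<open>-c\<close> is the
  divergence of \<open>-c x\<^sub>0\<close>.

  For the converse, integrate the difference of the divergences along two polynomial field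
  configurations whose jets agree to high order on the boundary of a box: the result is 0 by the
  fundamental theorem of calculus. Comparing \<open>\<phi> + v \<rho>\<close>, \<open>W\<^sup>a\<^sub>\<mu> = w\<^sub>a \<partial>\<^sub>\<mu>\<rho>\<close>, \<open>B\<^sub>\<mu> = b \<partial>\<^sub>\<mu>\<rho>\<close> with
  the constant configuration \<open>\<phi>\<close> gives
  \<open>\<integral> \<Sum>\<^sub>\<mu> g\<^sub>\<mu>\<^sub>\<mu> (\<partial>\<^sub>\<mu>\<rho>)\<^sup>2 Q(\<phi> + \<rho> v; v, w, b) - (P(\<phi> + \<rho> v) - P(\<phi>)) = 0\<close>. Stretching the box in the
  \<open>x\<^sub>0\<close>-direction isolates the \<open>(\<partial>\<^sub>0\<rho>)\<^sup>2\<close> term, and shrinking the amplitude yields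
  \<open>Q(\<phi>; v, w, b) = 0\<close>. Letting \<open>\<rho>\<close> tend to 1 inside the box then gives \<open>P(\<phi> + v) = P(\<phi>)\<close>.
\<close>

section \<open>The chain rule for functions of finitely many coordinates\<close>

lemma tendsto_coordinatewiseI:
  fixes X :: "'a \<Rightarrow> 'c \<Rightarrow> 'b::topological_space"
  assumes "\<And>c. ((\<lambda>t. X t c) \<longlongrightarrow> l c) F"
  shows "(X \<longlongrightarrow> l) F"
proof -
  have "limitin (product_topology (\<lambda>c. euclidean) UNIV) X l F"
    unfolding limitin_componentwise using assms by (simp add: eventually_mono)
  then show ?thesis by (simp add: euclidean_product_topology)
qed

lemma partial_deriv_has_derivative:
  assumes "\<And>z. (\<lambda>t. f (z(c := t))) field_differentiable at (z c)"
  shows "((\<lambda>t. f (w(c := t))) has_real_derivative partial_deriv c f (w(c := s))) (at s)"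
  using field_differentiable_derivI[OF assms[of "w(c := s)"]] by (simp add: partial_deriv_def)

text \<open>The bound on \<theta> assumes no order between \<open>a\<close> and \<open>b\<close> and
  squeezes \<theta> to \<open>a\<close> as \<open>b\<close> tends to \<open>a\<close>.\<close>

lemma partial_deriv_mvt:
  assumes "\<And>z. (\<lambda>t. f (z(c := t))) field_differentiable at (z c)"
  shows "\<exists>\<theta>. \<bar>\<theta> - a\<bar> \<le> \<bar>b - a\<bar> \<and>
    f (w(c := b)) - f (w(c := a)) = (b - a) * partial_deriv c f (w(c := \<theta>))"
proof -
  note D = partial_deriv_has_derivative[OF assms, where w = w]
  consider "a < b" | "b < a" | "a = b" by linarith
  then show ?thesis
  proof cases
    case 1
    from MVT2[OF this D] obtain z where "z > a" "z < b"
      "f (w(c := b)) - f (w(c := a)) = (b - a) * partial_deriv c f (w(c := z))" by blast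
    then show ?thesis by (intro exI[of _ z]) auto
  next
    case 2
    from MVT2[OF this D] obtain z where "z > b" "z < a"
      "f (w(c := a)) - f (w(c := b)) = (a - b) * partial_deriv c f (w(c := z))" by blast
    then show ?thesis by (intro exI[of _ z]) (auto simp: algebra_simps)
  qed auto
qed

text \<open>Only the coordinates in \<open>T\<close> move along the curve; the others stay frozen at
  time \<open>t0\<close>. When one more coordinate is set in motion, the increment it causes is a
  mean value of its partial derivative, and continuity of that derivative gives the limit.\<close>

lemma chain_rule_coordinates:
  fixes f :: "('c \<Rightarrow> real) \<Rightarrow> real"
  assumes "finite T"
    and "\<And>c. c \<in> T \<Longrightarrow> continuous_on UNIV (partial_deriv c f)"
    and "\<And>c z. c \<in> T \<Longrightarrow> (\<lambda>t. f (z(c := t))) field_differentiable at (z c)"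
    and "\<And>c. c \<in> T \<Longrightarrow> ((\<lambda>t. Z t c) has_real_derivative Z' c) (at t0)"
  shows "((\<lambda>t. f (\<lambda>c. if c \<in> T then Z t c else Z t0 c)) has_real_derivative
    (\<Sum>c\<in>T. Z' c * partial_deriv c f (Z t0))) (at t0)"
  using assms
proof (induction T)
  case empty
  then show ?case by simp
next
  case (insert c T)
  define A where "A t = (\<lambda>x. if x \<in> T then Z t x else Z t0 x)" for t
  have IH: "((\<lambda>t. f (A t)) has_real_derivative (\<Sum>c\<in>T. Z' c * partial_deriv c f (Z t0))) (at t0)"
    unfolding A_def using insert by auto
  have upd: "(\<lambda>x. if x \<in> insert c T then Z t x else Z t0 x) = (A t)(c := Z t c)" for t
    by (auto simp: A_def)
  have A0: "(A t)(c := Z t0 c) = A t" "A t0 = Z t0" for t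
    using insert.hyps by (auto simp: A_def)
  \<comment> \<open>The intermediate point depends on \<open>t\<close>; choice turns it into a
    function whose limit at \<open>t0\<close> is forced by the bound.\<close>
  obtain \<theta> where \<theta>: "\<And>t. \<bar>\<theta> t - Z t0 c\<bar> \<le> \<bar>Z t c - Z t0 c\<bar>"
    "\<And>t. f ((A t)(c := Z t c)) - f (A t) = (Z t c - Z t0 c) * partial_deriv c f ((A t)(c := \<theta> t))"
  proof -
    have "\<forall>t. \<exists>\<theta>. \<bar>\<theta> - Z t0 c\<bar> \<le> \<bar>Z t c - Z t0 c\<bar> \<and>
      f ((A t)(c := Z t c)) - f (A t) = (Z t c - Z t0 c) * partial_deriv c f ((A t)(c := \<theta>))"
      (is "\<forall>t. ?P t")
    proof
      fix t show "?P t"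
        using partial_deriv_mvt[OF insert.prems(2)[OF insertI1], where a = "Z t0 c" and w = "A t" and b = "Z t c"]
        by (simp only: A0(1))
    qed
    from choice[OF this] obtain \<theta> where "\<forall>t. \<bar>\<theta> t - Z t0 c\<bar> \<le> \<bar>Z t c - Z t0 c\<bar> \<and>
      f ((A t)(c := Z t c)) - f (A t) = (Z t c - Z t0 c) * partial_deriv c f ((A t)(c := \<theta> t))" ..
    then show ?thesis by (intro that[of \<theta>]) (simp_all del: fun_upd_apply)
  qed
  have Zc: "((\<lambda>t. Z t x) \<longlongrightarrow> Z t0 x) (at t0)" if "x \<in> insert c T" for x
    using DERIV_isCont[OF insert.prems(3)[OF that]] by (simp add: isCont_def)
  have "((\<lambda>t. \<theta> t - Z t0 c) \<longlongrightarrow> 0) (at t0)"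
  proof (rule tendsto_0_le[where K = 1])
    show "((\<lambda>t. Z t c - Z t0 c) \<longlongrightarrow> 0) (at t0)"
      using Zc[OF insertI1] by (simp add: LIM_zero)
  qed (use \<theta>(1) in auto)
  then have \<theta>_lim: "(\<theta> \<longlongrightarrow> Z t0 c) (at t0)"
    by (simp add: LIM_zero_iff)
  have "((\<lambda>t. (A t)(c := \<theta> t)) \<longlongrightarrow> Z t0) (at t0)"
  proof (rule tendsto_coordinatewiseI)
    fix x show "((\<lambda>t. ((A t)(c := \<theta> t)) x) \<longlongrightarrow> Z t0 x) (at t0)"
      using \<theta>_lim Zc[of x] by (cases "x = c"; cases "x \<in> T") (simp_all add: A_def)
  qed
  then have h: "((\<lambda>t. partial_deriv c f ((A t)(c := \<theta> t))) \<longlongrightarrow> partial_deriv c f (Z t0)) (at t0)"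
    by (rule continuous_on_tendsto_compose[OF insert.prems(1)[OF insertI1]]) simp_all
  have "((\<lambda>t. f ((A t)(c := Z t c)) - f (A t)) has_real_derivative Z' c * partial_deriv c f (Z t0)) (at t0)"
    unfolding has_field_derivative_iff
  proof (rule Lim_transform_eventually)
    show "((\<lambda>t. (Z t c - Z t0 c) / (t - t0) * partial_deriv c f ((A t)(c := \<theta> t)))
        \<longlongrightarrow> Z' c * partial_deriv c f (Z t0)) (at t0)"
      using insert.prems(3)[OF insertI1] h by (intro tendsto_mult) (auto simp: has_field_derivative_iff)
  qed (auto simp: \<theta>(2))
  from DERIV_add[OF this IH] show ?case
    unfolding upd using insert.hyps by simp
qed

lemma smooth_function_of_continuous:
  assumes "smooth_function_of S f"
  shows "continuous_on UNIV f" "continuous_on UNIV (partial_deriv c f)"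
proof -
  have s: "\<And>cs. continuous_on UNIV (foldr partial_deriv cs f)"
    using assms by (simp add: smooth_function_of_def)
  show "continuous_on UNIV f" "continuous_on UNIV (partial_deriv c f)"
    using s[of "[]"] s[of "[c]"] by simp_all
qed

lemma chain_rule_smooth:
  assumes "finite S" "smooth_function_of S f"
    and Z: "\<And>c. c \<in> S \<Longrightarrow> ((\<lambda>t. Z t c) has_real_derivative Z' c) (at t0)"
  shows "((\<lambda>t. f (Z t)) has_real_derivative (\<Sum>c\<in>S. Z' c * partial_deriv c f (Z t0))) (at t0)"
proof -
  have s: "depends_only_on S f" "\<And>cs c z. (\<lambda>t. foldr partial_deriv cs f (z(c := t))) field_differentiable at (z c)"
    using assms(2) by (auto simp: smooth_function_of_def)
  have "((\<lambda>t. f (\<lambda>c. if c \<in> S then Z t c else Z t0 c)) has_real_derivative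
    (\<Sum>c\<in>S. Z' c * partial_deriv c f (Z t0))) (at t0)"
  proof (rule chain_rule_coordinates[where f = f and Z = Z and Z' = Z'])
    show "(\<lambda>t. f (z(c := t))) field_differentiable at (z c)" for c z
      using s(2)[of "[]" z c] by (simp del: fun_upd_apply)
  qed (use assms(1) smooth_function_of_continuous(2)[OF assms(2)] Z in auto)
  moreover have "f (\<lambda>c. if c \<in> S then Z t c else Z t0 c) = f (Z t)" for t
    using s(1) by (auto simp: depends_only_on_def)
  ultimately show ?thesis by simp
qed

section \<open>The total derivative as a sum over finitely many coordinates\<close>

lemma partial_deriv_eq_0:
  assumes "depends_only_on S f" "c \<notin> S"
  shows "partial_deriv c f z = 0"
proof -
  have "(\<lambda>t. f (z(c := t))) = (\<lambda>t. f z)"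
    using assms unfolding depends_only_on_def by (metis fun_upd_apply)
  then show ?thesis by (simp add: partial_deriv_def)
qed

text \<open>The total derivative, in direction \<mu>, of the coordinate function \<open>c\<close>
  itself.\<close>

definition jet_shift :: "nat \<Rightarrow> jet \<Rightarrow> jet_coord \<Rightarrow> real" where
  "jet_shift \<mu> z c = (case c of Spacetime \<nu> \<Rightarrow> of_bool (\<nu> = \<mu>) | Jet u J \<Rightarrow> z (Jet u (add_mset \<mu> J)))"

text \<open>The sum in \<open>total_deriv\<close> runs over a support that varies with
  \<open>z\<close>. Enlarging both index sets to a common one adds only vanishing terms; the fixed
  set \<open>S\<close> then makes continuity in \<open>z\<close> and the chain rule
  applicable.\<close>

lemma total_deriv_eq_sum:
  assumes "finite S" "depends_only_on S f"
  shows "total_deriv \<mu> f z = (\<Sum>c\<in>S. jet_shift \<mu> z c * partial_deriv c f z)"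
proof -
  let ?J = "{(u, J). partial_deriv (Jet u J) f z \<noteq> 0}"
  let ?g = "\<lambda>c. jet_shift \<mu> z c * partial_deriv c f z"
  let ?C = "insert (Spacetime \<mu>) ((\<lambda>(u, J). Jet u J) ` ?J)"
  have fin: "finite ?J" by (rule finite_partial_deriv_support[OF assms])
  have inj: "inj_on (\<lambda>(u, J). Jet u J) ?J" by (auto simp: inj_on_def)
  have "(\<Sum>c\<in>S. ?g c) = (\<Sum>c\<in>S \<union> ?C. ?g c)"
    by (rule sum.mono_neutral_left) (use assms fin partial_deriv_eq_0[OF assms(2)] in auto)
  also have "\<dots> = (\<Sum>c\<in>?C. ?g c)"
  proof (rule sum.mono_neutral_right)
    show "\<forall>c\<in>S \<union> ?C - ?C. ?g c = 0"
    proof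
      fix c assume "c \<in> S \<union> ?C - ?C"
      then show "?g c = 0" by (cases c) (auto simp: jet_shift_def image_iff)
    qed
  qed (use assms fin in auto)
  also have "\<dots> = ?g (Spacetime \<mu>) + (\<Sum>c\<in>(\<lambda>(u, J). Jet u J) ` ?J. ?g c)"
    using fin by (subst sum.insert) auto
  also have "\<dots> = total_deriv \<mu> f z"
    unfolding total_deriv_def by (subst sum.reindex[OF inj]) (auto simp: jet_shift_def case_prod_unfold intro!: sum.cong)
  finally show ?thesis ..
qed

section \<open>Integration over the box\<close>

text \<open>The cube is a product over \<open>{..<d}\<close> because \<open>d\<close> is a term, not
  a type. Its points are \<open>undefined\<close> at all other indices, hence the condition below
  that integrands depend on the first \<open>d\<close> coordinates only. The open interval provides
  the strict inequalities used for the polynomial profiles.\<close>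

definition box_measure :: "nat \<Rightarrow> (nat \<Rightarrow> real) measure" where
  "box_measure d = Pi\<^sub>M {..<d} (\<lambda>_. restrict_space lborel {-1<..<1})"

lemma finite_measure_unit_interval: "finite_measure (restrict_space lborel {-1<..<1::real})"
  by (rule finite_measureI) (simp add: space_restrict_space emeasure_restrict_space)

lemma product_sigma_finite_unit_interval:
  "product_sigma_finite (\<lambda>_::nat. restrict_space lborel {-1<..<1::real})"
  using finite_measure_unit_interval
  by (simp add: product_sigma_finite_def finite_measure.axioms(1))

lemma space_box_measure: "y \<in> space (box_measure d) \<Longrightarrow> i < d \<Longrightarrow> -1 < y i \<and> y i < 1"
  by (auto simp: box_measure_def space_PiM space_restrict_space PiE_iff)

lemma integrable_box_const: "integrable (box_measure d) (\<lambda>_. c::real)"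
proof -
  interpret finite_measure "restrict_space lborel {-1<..<1::real}"
    by (rule finite_measure_unit_interval)
  have "integrable (box_measure d) (\<lambda>x. \<Prod>i<d. (\<lambda>_ _. 1::real) i (x i))"
    unfolding box_measure_def
    by (rule product_sigma_finite.product_integrable_prod[OF product_sigma_finite_unit_interval]) auto
  then have "integrable (box_measure d) (\<lambda>x. c * 1)"
    by (intro integrable_mult_right) simp
  then show ?thesis by simp
qed

lemma measurable_box_continuous:
  fixes H :: "(nat \<Rightarrow> real) \<Rightarrow> real"
  assumes "continuous_on UNIV H" "depends_only_on {..<d} H"
  shows "H \<in> borel_measurable (box_measure d)"
proof -
  \<comment> \<open>Replaces the \<open>undefined\<close> coordinates by 0, so that measurability
    into the full product can be checked coordinate by coordinate; \<open>H\<close> does not see the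
    change.\<close>
  let ?e = "\<lambda>y::nat \<Rightarrow> real. \<lambda>i. if i < d then y i else 0"
  have "(\<lambda>y. ?e y i) \<in> borel_measurable (box_measure d)" for i
  proof (cases "i < d")
    case True
    have "(\<lambda>y. y i) \<in> measurable (box_measure d) (restrict_space lborel {-1<..<1})"
      unfolding box_measure_def by (rule measurable_component_singleton) (use True in auto)
    moreover have "(\<lambda>x. x) \<in> borel_measurable (restrict_space lborel {-1<..<1::real})"
      by (rule measurable_restrict_space1) simp
    ultimately show ?thesis
      using True measurable_compose by fastforce
  qed simp
  then have "?e \<in> borel_measurable (box_measure d)"
    by (rule measurable_coordinatewise_then_product)
  then have "(\<lambda>y. H (?e y)) \<in> borel_measurable (box_measure d)"
    by (rule measurable_compose) (rule borel_measurable_continuous_onI[OF assms(1)])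
  moreover have "H (?e y) = H y" for y
    using assms(2) by (auto simp: depends_only_on_def)
  ultimately show ?thesis by simp
qed

text \<open>A continuous function is bounded on the closed cube, which is compact by Tychonoff once
  the coordinates from \<open>d\<close> on are pinned to 0, and constants are integrable.\<close>

lemma integrable_box_continuous:
  fixes H :: "(nat \<Rightarrow> real) \<Rightarrow> real"
  assumes "continuous_on UNIV H" "depends_only_on {..<d} H"
  shows "integrable (box_measure d) H"
proof -
  let ?e = "\<lambda>y::nat \<Rightarrow> real. \<lambda>i. if i < d then y i else 0"
  let ?K = "Pi\<^sub>E UNIV (\<lambda>i. if i < d then {-1..1::real} else {0})"
  have "compactin (product_topology (\<lambda>i. euclidean) UNIV) ?K"
    unfolding compactin_PiE by (auto simp: compactin_euclidean_iff)
  then have "compact ?K"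
    by (simp add: euclidean_product_topology compactin_euclidean_iff)
  then have "compact (H ` ?K)"
    using assms(1) by (intro compact_continuous_image) (auto intro: continuous_on_subset)
  then obtain B where B: "\<And>x. x \<in> ?K \<Longrightarrow> norm (H x) \<le> B"
    using compact_imp_bounded bounded_iff by (metis imageI)
  have "norm (H y) \<le> B" if "y \<in> space (box_measure d)" for y
  proof -
    have "H y = H (?e y)"
      using assms(2) by (auto simp: depends_only_on_def)
    moreover have "?e y \<in> ?K"
      using space_box_measure[OF that] by (auto simp: less_imp_le)
    ultimately show ?thesis using B by metis
  qed
  then show ?thesis
    by (intro Bochner_Integration.integrable_bound[OF integrable_box_const[of d B] measurable_box_continuous[OF assms]])
      (auto intro!: AE_I2 order_trans[OF _ abs_ge_self])
qed

lemma integral_unit_interval_derivative: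
  fixes G :: "real \<Rightarrow> real"
  assumes "continuous_on UNIV G'" "\<And>t. (G has_real_derivative G' t) (at t)"
  shows "integral\<^sup>L (restrict_space lborel {-1<..<1}) G' = G 1 - G (-1)"
proof -
  have "integral\<^sup>L (restrict_space lborel {-1<..<1}) G' =
    integral\<^sup>L lborel (\<lambda>x. indicator {-1<..<1} x *\<^sub>R G' x)"
    by (rule integral_restrict_space) simp
  also have "\<dots> = integral\<^sup>L lborel (\<lambda>x. indicator {-1..1} x *\<^sub>R G' x)"
  proof (rule integral_discrete_difference[where X = "{-1, 1}"])
    fix x :: real assume "x \<notin> {-1, 1}"
    then show "indicator {-1<..<1} x *\<^sub>R G' x = indicator {-1..1} x *\<^sub>R G' x"
      by (auto simp: indicator_def)
  qed auto
  also have "\<dots> = G 1 - G (-1)"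
    by (rule integral_FTC_atLeastAtMost)
      (use assms in \<open>auto simp flip: has_real_derivative_iff_has_vector_derivative
        intro: has_field_derivative_at_within continuous_on_subset\<close>)
  finally show ?thesis .
qed

lemma continuous_on_fun_upd: "continuous_on UNIV (\<lambda>t::real. (y::'c \<Rightarrow> real)(c := t))"
proof (rule continuous_on_coordinatewise_then_product)
  show "continuous_on UNIV (\<lambda>t. (y(c := t)) i)" for i
    by (cases "i = c") simp_all
qed

text \<open>The divergence theorem for a single component: integrating first over coordinate \<mu>
  by Fubini, the fundamental theorem of calculus leaves the difference of \<open>G\<close> at two
  opposite faces, where it is zero.\<close>

lemma integral_box_derivative:
  assumes "\<mu> < d"
    and cont: "continuous_on UNIV G'" and dep: "depends_only_on {..<d} G'"
    and deriv: "\<And>y. ((\<lambda>t. G (y(\<mu> := t))) has_real_derivative G' y) (at (y \<mu>))"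
    and vanish: "\<And>y. \<bar>y \<mu>\<bar> = 1 \<Longrightarrow> G y = 0"
  shows "integral\<^sup>L (box_measure d) G' = 0"
proof -
  have ins: "insert \<mu> ({..<d} - {\<mu>}) = {..<d}" using assms(1) by auto
  have 1: "integral\<^sup>L (box_measure d) G' =
    (\<integral>y. (\<integral>t. G' (y(\<mu> := t)) \<partial>restrict_space lborel {-1<..<1})
      \<partial>Pi\<^sub>M ({..<d} - {\<mu>}) (\<lambda>_. restrict_space lborel {-1<..<1}))"
    using product_sigma_finite.product_integral_insert[OF product_sigma_finite_unit_interval,
        of "{..<d} - {\<mu>}" \<mu> G'] integrable_box_continuous[OF cont dep]
    unfolding ins box_measure_def by simp
  have 2: "(\<integral>t. G' (y(\<mu> := t)) \<partial>restrict_space lborel {-1<..<1}) = 0" for y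
  proof -
    have D: "((\<lambda>t. G (y(\<mu> := t))) has_real_derivative G' (y(\<mu> := t))) (at t)" for t
      using deriv[of "y(\<mu> := t)"] by simp
    have "(\<integral>t. G' (y(\<mu> := t)) \<partial>restrict_space lborel {-1<..<1}) = G (y(\<mu> := 1)) - G (y(\<mu> := -1))"
      by (rule integral_unit_interval_derivative[where G = "\<lambda>t. G (y(\<mu> := t))"])
        (rule continuous_on_compose2[OF cont continuous_on_fun_upd subset_UNIV], rule D)
    also have "\<dots> = 0" by (simp add: vanish)
    finally show ?thesis .
  qed
  show ?thesis unfolding 1 2 by simp
qed

text \<open>A square with zero integral vanishes almost everywhere, but a nonzero polynomial has
  finitely many roots and the interval has positive measure.\<close>

lemma integral_unit_interval_poly_pos:
  fixes p :: "real poly"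
  assumes "p \<noteq> 0"
  shows "integrable (restrict_space lborel {-1<..<1}) (\<lambda>x. (poly p x)\<^sup>2)"
    and "integral\<^sup>L (restrict_space lborel {-1<..<1}) (\<lambda>x. (poly p x)\<^sup>2) \<noteq> 0"
proof -
  have "set_integrable lborel {-1<..<1} (\<lambda>x. (poly p x)\<^sup>2)"
    by (rule set_integrable_subset[OF borel_integrable_atLeastAtMost'[of "-1" 1]])
      (auto intro!: continuous_intros)
  then show int: "integrable (restrict_space lborel {-1<..<1}) (\<lambda>x. (poly p x)\<^sup>2)"
    by (simp add: integrable_restrict_space set_integrable_def)
  show "integral\<^sup>L (restrict_space lborel {-1<..<1}) (\<lambda>x. (poly p x)\<^sup>2) \<noteq> 0"
  proof
    assume "integral\<^sup>L (restrict_space lborel {-1<..<1}) (\<lambda>x. (poly p x)\<^sup>2) = 0"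
    then have "AE x in restrict_space lborel {-1<..<1}. (poly p x)\<^sup>2 = 0"
      using integral_nonneg_eq_0_iff_AE[OF int] by simp
    then have "AE x in lborel. x \<in> {-1<..<1} \<longrightarrow> poly p x = 0"
      by (simp add: AE_restrict_space_iff)
    moreover have "AE x in lborel. poly p x \<noteq> 0"
      using poly_roots_finite[OF assms] by (intro AE_I'[OF finite_imp_null_set_lborel]) auto
    ultimately have "AE x in lborel. x \<notin> {-1<..<1::real}"
      by eventually_elim auto
    then have "emeasure lborel {-1<..<1::real} = 0"
      by (subst (asm) AE_iff_measurable[where N = "{-1<..<1}"]) auto
    then show False by simp
  qed
qed

section \<open>Test fields\<close>

text \<open>With \<open>\<rho>(x) = \<Prod>\<^sub>\<nu> r(x\<^sub>\<nu> / R \<nu>)\<close>, \<open>bump d R r J y\<close> is the derivative \<open>\<partial>\<^sub>J \<rho>\<close> at the point \<open>x\<^sub>\<nu> = R \<nu> * y\<^sub>\<nu>\<close>.\<close>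

definition bump :: "nat \<Rightarrow> (nat \<Rightarrow> real) \<Rightarrow> real poly \<Rightarrow> nat multiset \<Rightarrow> (nat \<Rightarrow> real) \<Rightarrow> real" where
  "bump d R r J y = (\<Prod>\<nu><d. (1 / R \<nu>) ^ count J \<nu> * poly ((pderiv ^^ count J \<nu>) r) (y \<nu>))"

text \<open>Differentiation is in \<open>y\<close>, whereas \<rho> is a function of
  \<open>x\<close>; the factor \<open>R \<mu>\<close> is the inner derivative.\<close>

lemma bump_has_derivative:
  assumes "\<mu> < d" "R \<mu> \<noteq> 0"
  shows "((\<lambda>t. bump d R r J (y(\<mu> := t))) has_real_derivative R \<mu> * bump d R r (add_mset \<mu> J) y) (at (y \<mu>))"
proof -
  let ?c = "\<Prod>\<nu>\<in>{..<d} - {\<mu>}. (1 / R \<nu>) ^ count J \<nu> * poly ((pderiv ^^ count J \<nu>) r) (y \<nu>)"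
  have \<mu>: "finite {..<d}" "\<mu> \<in> {..<d}" using assms by auto
  have 1: "bump d R r J (y(\<mu> := t)) = (1 / R \<mu>) ^ count J \<mu> * poly ((pderiv ^^ count J \<mu>) r) t * ?c" for t
  proof -
    have "(\<Prod>\<nu>\<in>{..<d} - {\<mu>}. (1 / R \<nu>) ^ count J \<nu> * poly ((pderiv ^^ count J \<nu>) r) ((y(\<mu> := t)) \<nu>)) = ?c"
      by (rule prod.cong) auto
    then show ?thesis unfolding bump_def by (subst prod.remove[OF \<mu>]) simp
  qed
  have 2: "R \<mu> * bump d R r (add_mset \<mu> J) y =
    (1 / R \<mu>) ^ count J \<mu> * poly (pderiv ((pderiv ^^ count J \<mu>) r)) (y \<mu>) * ?c"
  proof -
    have "(\<Prod>\<nu>\<in>{..<d} - {\<mu>}. (1 / R \<nu>) ^ count (add_mset \<mu> J) \<nu> *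
        poly ((pderiv ^^ count (add_mset \<mu> J) \<nu>) r) (y \<nu>)) = ?c"
      by (rule prod.cong) auto
    then show ?thesis
      unfolding bump_def using assms(2) by (subst prod.remove[OF \<mu>]) (simp add: field_simps)
  qed
  show ?thesis
    unfolding 1 2 by (intro DERIV_cmult DERIV_cmult_right poly_DERIV)
qed

lemma bump_cong: "(\<And>i. i < d \<Longrightarrow> y i = y' i) \<Longrightarrow> bump d R r J y = bump d R r J y'"
  unfolding bump_def by (intro prod.cong) auto

lemma continuous_bump: "continuous_on UNIV (bump d R r J)"
  unfolding bump_def by (intro continuous_intros continuous_on_product_coordinates)

text \<open>Each differentiation lowers the multiplicity of a factor by at most one.\<close>

lemma dvd_higher_pderiv:
  fixes q r :: "real poly"
  assumes "q ^ m dvd r" "k \<le> m"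
  shows "q ^ (m - k) dvd (pderiv ^^ k) r"
  using assms(2)
proof (induction k)
  case 0
  then show ?case using assms(1) by simp
next
  case (Suc k)
  then obtain s where s: "(pderiv ^^ k) r = q ^ Suc (m - Suc k) * s"
    by (auto simp: dvd_def Suc_diff_Suc)
  have "q ^ (m - Suc k) dvd pderiv (q ^ Suc (m - Suc k) * s)"
    unfolding pderiv_mult pderiv_power_Suc by (intro dvd_add dvd_mult dvd_mult2 dvd_smult) auto
  then show ?case using s by simp
qed

text \<open>\<open>[:1, 0, -1:]\<close> is \<open>1 - x^2\<close>, with roots at both ends of the
  interval. Fewer than \<open>m\<close> derivatives leave at least one copy of it in the factor of
  direction \<mu>.\<close>

lemma bump_vanishes:
  assumes "\<mu> < d" "[:1, 0, -1:] ^ m dvd r" "count J \<mu> < m" "\<bar>y \<mu>\<bar> = 1"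
  shows "bump d R r J y = 0"
proof -
  have "[:1, 0, -1:] dvd [:1, 0, -1::real:] ^ (m - count J \<mu>)"
    using assms(3) by (intro dvd_power) auto
  also have "\<dots> dvd (pderiv ^^ count J \<mu>) r"
    using assms by (intro dvd_higher_pderiv) auto
  finally have "poly ((pderiv ^^ count J \<mu>) r) (y \<mu>) = 0"
    using assms(4) by (auto simp: dvd_def abs_if split: if_splits)
  then show ?thesis
    unfolding bump_def using assms(1) by (intro prod_zero) auto
qed

lemma bump_empty: "bump d R r {#} y = (\<Prod>\<nu><d. poly r (y \<nu>))"
  by (simp add: bump_def)

lemma bump_single: "\<mu> < d \<Longrightarrow> bump d R r {#\<mu>#} y = 1 / R \<mu> * bump d (\<lambda>_. 1) r {#\<mu>#} y"
  by (simp add: bump_def prod.remove[of _ \<mu>])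

text \<open>The jet at \<open>x\<^sub>\<nu> = R \<nu> * y\<^sub>\<nu>\<close> of the fields \<open>\<phi>\<^sub>i + v\<^sub>i \<rho>\<close>, \<open>W\<^sup>a\<^sub>\<mu> = w\<^sub>a \<partial>\<^sub>\<mu>\<rho>\<close>, \<open>B\<^sub>\<mu> = b \<partial>\<^sub>\<mu>\<rho>\<close>. The gauge
  fields are proportional to \<open>\<partial>\<^sub>\<mu>\<rho>\<close> so that homogeneity extracts a factor \<open>(\<partial>\<^sub>\<mu>\<rho>)\<^sup>2\<close> from the kinetic terms.\<close>

definition test_jet :: "nat \<Rightarrow> (nat \<Rightarrow> real) \<Rightarrow> real poly \<Rightarrow> (nat \<Rightarrow> real) \<Rightarrow> (nat \<Rightarrow> real) \<Rightarrow> (nat \<Rightarrow> real) \<Rightarrow>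
    real \<Rightarrow> (nat \<Rightarrow> real) \<Rightarrow> jet" where
  "test_jet d R r \<phi> v w b y c = (case c of
     Spacetime \<nu> \<Rightarrow> R \<nu> * (if \<nu> < d then y \<nu> else 0)
   | Jet u J \<Rightarrow> (case u of
       Scalar i \<Rightarrow> of_bool (J = {#}) * \<phi> i + v i * bump d R r J y
     | WField a \<nu> \<Rightarrow> w a * bump d R r (add_mset \<nu> J) y
     | BField \<nu> \<Rightarrow> b * bump d R r (add_mset \<nu> J) y))"

text \<open>The test jet comes from actual fields: moving the base point changes each jet coordinate
  at the rate given by the coordinate with one more derivative. This turns total derivatives into
  ordinary ones.\<close>

lemma test_jet_has_derivative:
  assumes "\<mu> < d" "R \<mu> \<noteq> 0"
  shows "((\<lambda>t. test_jet d R r \<phi> v w b (y(\<mu> := t)) c) has_real_derivative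
    R \<mu> * jet_shift \<mu> (test_jet d R r \<phi> v w b y) c) (at (y \<mu>))"
proof (cases c)
  case (Spacetime \<nu>)
  then show ?thesis
    using assms(1) by (cases "\<nu> = \<mu>"; cases "\<nu> < d")
      (auto simp: test_jet_def jet_shift_def intro!: derivative_eq_intros)
next
  case (Jet u J)
  have B: "((\<lambda>t. k + a * bump d R r J (y(\<mu> := t))) has_real_derivative
      R \<mu> * (a * bump d R r (add_mset \<mu> J) y)) (at (y \<mu>))" for k a J
    using bump_has_derivative[where d = d and R = R and \<mu> = \<mu> and y = y and r = r and J = J, OF assms]
    by (auto intro!: derivative_eq_intros simp: mult_ac)
  show ?thesis
    using B B[of 0, where J = "add_mset _ J"] add_mset_commute[of \<mu> _ J]
    by (cases u) (simp_all add: Jet test_jet_def jet_shift_def)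
qed

lemma test_jet_cong:
  "(\<And>i. i < d \<Longrightarrow> y i = y' i) \<Longrightarrow> test_jet d R r \<phi> v w b y = test_jet d R r \<phi> v w b y'"
  using bump_cong[of d y y' R r] by (auto simp: test_jet_def fun_eq_iff split: jet_coord.split field_var.split)

lemma continuous_test_jet: "continuous_on UNIV (test_jet d R r \<phi> v w b)"
proof (rule continuous_on_coordinatewise_then_product)
  fix c
  show "continuous_on UNIV (\<lambda>y. test_jet d R r \<phi> v w b y c)"
  proof (cases c)
    case (Spacetime \<nu>)
    then show ?thesis by (cases "\<nu> < d") (auto simp: test_jet_def intro!: continuous_intros)
  next
    case (Jet u J)
    then show ?thesis
      by (cases u) (auto simp: test_jet_def intro!: continuous_intros continuous_bump)
  qed
qed

text \<open>The two configurations differ only by derivatives of \<rho>, which vanish on the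
  boundary up to order below \<open>m\<close>. The \<open>+ 1\<close> accounts for the gauge fields,
  which are themselves first derivatives of \<rho>.\<close>

lemma test_jet_boundary:
  assumes "\<mu> < d" "[:1, 0, -1:] ^ m dvd r" "\<And>u J. c = Jet u J \<Longrightarrow> size J + 1 < m" "\<bar>y \<mu>\<bar> = 1"
  shows "test_jet d R r \<phi> v w b y c = test_jet d R r \<phi> (\<lambda>_. 0) (\<lambda>_. 0) 0 y c"
proof (cases c)
  case (Jet u J)
  then have J: "size J + 1 < m" using assms(3) by simp
  have z: "bump d R r J' y = 0" if "size J' < m" for J'
    by (rule bump_vanishes[where \<mu> = \<mu> and m = m and d = d and r = r and y = y and J = J', OF assms(1,2) le_less_trans[OF count_le_size] assms(4)]) (rule that)
  show ?thesis
    using J by (cases u) (simp_all add: Jet test_jet_def z)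
qed (simp add: test_jet_def)

text \<open>By the chain rule, \<open>R \<mu>\<close> times the total derivative along the test
  fields is a derivative in \<open>y \<mu>\<close>. The boundary values of \<open>f\<close> are
  arbitrary but equal for both configurations, so the difference integrates to zero.\<close>

lemma integral_total_deriv_test_jet:
  fixes \<phi> v w :: "nat \<Rightarrow> real" and b :: real
  assumes "\<mu> < d" "finite S" "smooth_function_of S f" "R \<mu> \<noteq> 0" "[:1, 0, -1:] ^ m dvd r"
    and "\<And>u J. Jet u J \<in> S \<Longrightarrow> size J + 1 < m"
  defines "z \<equiv> test_jet d R r \<phi> v w b" and "z0 \<equiv> test_jet d R r \<phi> (\<lambda>_. 0) (\<lambda>_. 0) 0"
  shows "integrable (box_measure d) (\<lambda>y. total_deriv \<mu> f (z y) - total_deriv \<mu> f (z0 y))"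
    and "(\<integral>y. total_deriv \<mu> f (z y) - total_deriv \<mu> f (z0 y) \<partial>box_measure d) = 0"
proof -
  have dep: "depends_only_on S f" using assms(3) by (simp add: smooth_function_of_def)
  let ?X = "\<lambda>y. total_deriv \<mu> f (z y) - total_deriv \<mu> f (z0 y)"
  have cont1: "continuous_on UNIV (\<lambda>y. total_deriv \<mu> f (test_jet d R r \<phi> v w b y))" for v w b
  proof -
    have "continuous_on UNIV (\<lambda>y. test_jet d R r \<phi> v w b y c)" for c
      using continuous_test_jet by (rule continuous_on_product_then_coordinatewise)
    then have "continuous_on UNIV (\<lambda>y. jet_shift \<mu> (test_jet d R r \<phi> v w b y) c)" for c
      by (cases c) (simp_all add: jet_shift_def)
    moreover have "continuous_on UNIV (\<lambda>y. partial_deriv c f (test_jet d R r \<phi> v w b y))" for c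
      by (rule continuous_on_compose2[OF smooth_function_of_continuous(2)[OF assms(3)] continuous_test_jet]) simp
    ultimately show ?thesis
      unfolding total_deriv_eq_sum[OF assms(2) dep] by (intro continuous_on_sum continuous_on_mult)
  qed
  have cont: "continuous_on UNIV ?X"
    unfolding z_def z0_def by (intro continuous_on_diff cont1)
  have depX: "depends_only_on {..<d} ?X"
    unfolding depends_only_on_def z_def z0_def
    by (metis test_jet_cong lessThan_iff)
  show "integrable (box_measure d) ?X"
    by (rule integrable_box_continuous[OF cont depX])
  have D: "((\<lambda>t. f (test_jet d R r \<phi> v w b (y(\<mu> := t)))) has_real_derivative
      R \<mu> * total_deriv \<mu> f (test_jet d R r \<phi> v w b y)) (at (y \<mu>))" for y v w b
    using chain_rule_smooth[OF assms(2,3), where Z = "\<lambda>t. test_jet d R r \<phi> v w b (y(\<mu> := t))" and ?t0.0 = "y \<mu>"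
        and Z' = "\<lambda>c. R \<mu> * jet_shift \<mu> (test_jet d R r \<phi> v w b y) c"]
      test_jet_has_derivative[where r = r and \<phi> = \<phi> and v = v and w = w and b = b
        and d = d and R = R and \<mu> = \<mu>, OF assms(1,4)]
    by (simp add: total_deriv_eq_sum[OF assms(2) dep] sum_distrib_left mult.assoc)
  have "(\<integral>y. R \<mu> * ?X y \<partial>box_measure d) = 0"
  proof (rule integral_box_derivative[OF assms(1), where G = "\<lambda>y. f (z y) - f (z0 y)"])
    show "continuous_on UNIV (\<lambda>y. R \<mu> * ?X y)" by (intro continuous_on_mult continuous_on_const cont)
    show "depends_only_on {..<d} (\<lambda>y. R \<mu> * ?X y)" using depX by (simp add: depends_only_on_def)
    show "((\<lambda>t. f (z (y(\<mu> := t))) - f (z0 (y(\<mu> := t)))) has_real_derivative R \<mu> * ?X y) (at (y \<mu>))" for y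
      unfolding z_def z0_def right_diff_distrib by (intro DERIV_diff D)
    show "f (z y) - f (z0 y) = 0" if "\<bar>y \<mu>\<bar> = 1" for y
    proof -
      have "z y c = z0 y c" if "c \<in> S" for c
        unfolding z_def z0_def
        by (rule test_jet_boundary[where \<mu> = \<mu> and m = m]) (use assms that \<open>\<bar>y \<mu>\<bar> = 1\<close> in auto)
      then show ?thesis using dep by (simp add: depends_only_on_def)
    qed
  qed
  then show "integral\<^sup>L (box_measure d) ?X = 0" using assms(4) by simp
qed

section \<open>Partial derivatives of polynomial potentials\<close>

lemma polynomial_function_of_has_derivative:
  assumes "finite S" "c \<in> S" "polynomial_function_of S p"
  shows "\<exists>(M :: ('c \<Rightarrow> nat) set) a. \<forall>x t. ((\<lambda>t. p (x(c := t))) has_real_derivative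
      (\<Sum>m\<in>M. a m * (real (m c) * t ^ (m c - 1) * (\<Prod>c\<in>S - {c}. x c ^ m c)))) (at t)"
proof -
  obtain M :: "('c \<Rightarrow> nat) set" and a where p: "p = (\<lambda>x. \<Sum>m\<in>M. a m * (\<Prod>c\<in>S. x c ^ m c))"
    using assms(3) unfolding polynomial_function_of_def by blast
  have upd: "p (x(c := t)) = (\<Sum>m\<in>M. a m * (t ^ m c * (\<Prod>c\<in>S - {c}. x c ^ m c)))" for x t
    unfolding p
  proof (intro sum.cong refl)
    fix m
    have "(\<Prod>k\<in>S - {c}. (x(c := t)) k ^ m k) = (\<Prod>k\<in>S - {c}. x k ^ m k)"
      by (rule prod.cong) auto
    then show "a m * (\<Prod>k\<in>S. (x(c := t)) k ^ m k) = a m * (t ^ m c * (\<Prod>c\<in>S - {c}. x c ^ m c))"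
      by (simp add: prod.remove[OF assms(1,2)])
  qed
  \<comment> \<open>For \<open>m c = 0\<close> the exponent \<open>m c - 1\<close> is truncated to
    0, harmlessly, since the factor \<open>real (m c)\<close> is then 0. As \<open>M\<close> and
    \<open>a\<close> do not depend on \<open>x\<close> and \<open>t\<close>, continuity of the
    derivative can be read off from this formula.\<close>
  have "((\<lambda>t. p (x(c := t))) has_real_derivative
      (\<Sum>m\<in>M. a m * (real (m c) * t ^ (m c - 1) * (\<Prod>c\<in>S - {c}. x c ^ m c)))) (at t)" for x t
    unfolding upd by (intro DERIV_sum DERIV_cmult DERIV_cmult_right) (auto intro!: derivative_eq_intros)
  then show ?thesis by blast
qed

lemma polynomial_function_of_field_differentiable:
  assumes "finite S" "c \<in> S" "polynomial_function_of S p"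
  shows "(\<lambda>t. p (x(c := t))) field_differentiable at t"
  using polynomial_function_of_has_derivative[OF assms] unfolding field_differentiable_def by blast

lemma polynomial_function_of_continuous_partial_deriv:
  assumes "finite S" "c \<in> S" "polynomial_function_of S p"
  shows "continuous_on UNIV (partial_deriv c p)"
proof -
  obtain M :: "('a \<Rightarrow> nat) set" and a where
    D: "\<forall>x t. ((\<lambda>t. p (x(c := t))) has_real_derivative
      (\<Sum>m\<in>M. a m * (real (m c) * t ^ (m c - 1) * (\<Prod>c\<in>S - {c}. x c ^ m c)))) (at t)"
    using polynomial_function_of_has_derivative[OF assms] by (elim exE)
  have "partial_deriv c p = (\<lambda>x. \<Sum>m\<in>M. a m * (real (m c) * x c ^ (m c - 1) * (\<Prod>c\<in>S - {c}. x c ^ m c)))"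
    unfolding partial_deriv_def by (rule ext) (rule DERIV_imp_deriv[OF D[rule_format]])
  then show ?thesis
    by (simp only:) (intro continuous_intros continuous_on_product_coordinates)
qed

section \<open>Prolongation of the Lagrangian\<close>

text \<open>The covariant derivative of a doublet in a single direction, with \<open>v\<close>
  standing for the derivatives of the scalars and \<open>w\<close>, \<open>b\<close> for the gauge
  components. Detached from jets, it carries no spacetime index and no dimension.\<close>

definition gauge_doublet ::
    "real \<Rightarrow> real \<Rightarrow> real \<Rightarrow> (nat \<Rightarrow> real) \<Rightarrow> (nat \<Rightarrow> real) \<Rightarrow> (nat \<Rightarrow> real) \<Rightarrow> real \<Rightarrow> nat \<Rightarrow> complex^2" where
  "gauge_doublet g g' Y \<phi> v w b n = doublet v n
     + (\<Sum>a=1..3. (\<i> * g * w a / 2) *s (pauli a *v doublet \<phi> n))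
     + (\<i> * g' * Y * b) *s doublet \<phi> n"

lemma Re_hermitian_product: "Re (hermitian_product v w) = v \<bullet> w"
  by (simp add: hermitian_product_def inner_vec_def inner_complex_def)

lemma hermitian_product_scaleR: "hermitian_product v (r *\<^sub>R w) = r *\<^sub>R hermitian_product v w"
  by (simp add: hermitian_product_def scaleR_sum_right)

lemma doublet_add_scale: "doublet (\<lambda>i. \<phi> i + t * \<psi> i) n = doublet \<phi> n + t *\<^sub>R doublet \<psi> n"
  by (simp add: doublet_def vec_eq_iff forall_2 complex_eq_iff field_simps)

lemma doublet_scale: "doublet (\<lambda>i. t * \<psi> i) n = t *\<^sub>R doublet \<psi> n"
  by (simp add: doublet_def vec_eq_iff forall_2 complex_eq_iff field_simps)

lemma doublet_zero: "doublet (\<lambda>_. 0) n = 0"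
  by (simp add: doublet_def vec_eq_iff forall_2 complex_eq_iff)

text \<open>For fixed gauge components the covariant derivative is linear in scalars and velocities
  jointly.\<close>

lemma gauge_doublet_add_scale:
  "gauge_doublet g g' Y (\<lambda>i. \<phi> i + t * \<psi> i) (\<lambda>i. v i + t * u i) w b n =
   gauge_doublet g g' Y \<phi> v w b n + t *\<^sub>R gauge_doublet g g' Y \<psi> u w b n"
proof -
  have "c *s (A *v (x + t *\<^sub>R y)) = c *s (A *v x) + t *\<^sub>R (c *s (A *v y))"
    "c *s (x + t *\<^sub>R y) = c *s x + t *\<^sub>R (c *s y)" for c :: complex and A :: "complex^2^2" and x y
    by (simp_all add: vec_eq_iff matrix_vector_mult_def sum_2 algebra_simps)
  then show ?thesis
    by (simp add: gauge_doublet_def doublet_add_scale scaleR_add_right scaleR_sum_right sum.distrib)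
qed

text \<open>Every term contains exactly one factor from \<open>v\<close>, \<open>w\<close>,
  \<open>b\<close>.\<close>

lemma gauge_doublet_scale:
  "gauge_doublet g g' Y \<phi> (\<lambda>i. s * v i) (\<lambda>a. s * w a) (s * b) n = s *\<^sub>R gauge_doublet g g' Y \<phi> v w b n"
proof -
  have *: "(c * complex_of_real (s * x)) *s y = s *\<^sub>R ((c * complex_of_real x) *s y)"
    "(c * complex_of_real (s * x) / 2) *s y = s *\<^sub>R ((c * complex_of_real x / 2) *s y)"
    for c and x and y :: "complex^2"
    by (simp_all add: vec_eq_iff scaleR_conv_of_real[where 'a = complex])
  show ?thesis
    unfolding gauge_doublet_def doublet_scale * scaleR_add_right scaleR_sum_right ..
qed

lemma gauge_doublet_zero_scalars: "gauge_doublet g g' Y (\<lambda>_. 0) v w b n = doublet v n"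
  by (simp add: gauge_doublet_def doublet_zero vec_eq_iff)

definition kinetic ::
    "nat \<Rightarrow> nat \<Rightarrow> real \<Rightarrow> real \<Rightarrow> real \<Rightarrow> (nat \<Rightarrow> real) \<Rightarrow> (nat \<Rightarrow> real) \<Rightarrow> (nat \<Rightarrow> real) \<Rightarrow> real \<Rightarrow> real" where
  "kinetic N K g g' Y \<phi> v w b =
     (\<Sum>n=1..N. gauge_doublet g g' Y \<phi> v w b n \<bullet> gauge_doublet g g' Y \<phi> v w b n)
     + (\<Sum>m=1..K. 1/2 * v (4 * N + m) * v (4 * N + m))"

text \<open>The directional derivative of \<open>kinetic\<close> at (\<phi>, \<open>v\<close>) along
  (\<psi>, \<open>u\<close>), the gauge components held fixed.\<close>

definition kinetic_variation ::
    "nat \<Rightarrow> nat \<Rightarrow> real \<Rightarrow> real \<Rightarrow> real \<Rightarrow> (nat \<Rightarrow> real) \<Rightarrow> (nat \<Rightarrow> real) \<Rightarrow>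
     (nat \<Rightarrow> real) \<Rightarrow> (nat \<Rightarrow> real) \<Rightarrow> (nat \<Rightarrow> real) \<Rightarrow> real \<Rightarrow> real" where
  "kinetic_variation N K g g' Y \<phi> v \<psi> u w b =
     (\<Sum>n=1..N. 2 * (gauge_doublet g g' Y \<phi> v w b n \<bullet> gauge_doublet g g' Y \<psi> u w b n))
     + (\<Sum>m=1..K. v (4 * N + m) * u (4 * N + m))"

lemma kinetic_has_derivative:
  "((\<lambda>t. kinetic N K g g' Y (\<lambda>i. \<phi> i + (t - a) * \<psi> i) (\<lambda>i. v i + (t - a) * u i) w b)
    has_real_derivative kinetic_variation N K g g' Y \<phi> v \<psi> u w b) (at a)"
proof -
  have "((\<lambda>t. (x + (t - a) *\<^sub>R y) \<bullet> (x + (t - a) *\<^sub>R y)) has_real_derivative 2 * (x \<bullet> y)) (at a)"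
    for x y :: "complex^2"
  proof -
    have "(\<lambda>t. (x + (t - a) *\<^sub>R y) \<bullet> (x + (t - a) *\<^sub>R y)) =
      (\<lambda>t. x \<bullet> x + 2 * (t - a) * (x \<bullet> y) + (t - a)\<^sup>2 * (y \<bullet> y))"
      by (simp add: inner_add_left inner_add_right inner_commute power2_eq_square algebra_simps)
    then show ?thesis by (auto intro!: derivative_eq_intros)
  qed
  then show ?thesis
    unfolding kinetic_def kinetic_variation_def gauge_doublet_add_scale
    by (intro DERIV_add DERIV_sum) (auto intro!: derivative_eq_intros)
qed

definition unit_vec :: "nat \<Rightarrow> nat \<Rightarrow> real" where
  "unit_vec i j = of_bool (j = i)"

lemma kinetic_has_derivative_scalar:
  "((\<lambda>t. kinetic N K g g' Y (\<phi>(i := t)) v w b)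
    has_real_derivative kinetic_variation N K g g' Y \<phi> v (unit_vec i) (\<lambda>_. 0) w b) (at (\<phi> i))"
proof -
  have "\<phi>(i := t) = (\<lambda>j. \<phi> j + (t - \<phi> i) * unit_vec i j)" for t
    by (auto simp: unit_vec_def)
  then show ?thesis
    using kinetic_has_derivative[of N K g g' Y \<phi> "\<phi> i" "unit_vec i" v "\<lambda>_. 0" w b] by simp
qed

lemma kinetic_has_derivative_velocity:
  "((\<lambda>t. kinetic N K g g' Y \<phi> (v(i := t)) w b)
    has_real_derivative kinetic_variation N K g g' Y \<phi> v (\<lambda>_. 0) (unit_vec i) w b) (at (v i))"
proof -
  have "v(i := t) = (\<lambda>j. v j + (t - v i) * unit_vec i j)" for t
    by (auto simp: unit_vec_def)
  then show ?thesis
    using kinetic_has_derivative[of N K g g' Y \<phi> "v i" "\<lambda>_. 0" v "unit_vec i" w b] by simp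
qed

section \<open>Splitting the Lagrangian by spacetime directions\<close>

abbreviation scalars :: "jet \<Rightarrow> nat \<Rightarrow> real" where
  "scalars z \<equiv> \<lambda>i. field_value z (Scalar i)"

abbreviation scalar_velocity :: "nat \<Rightarrow> jet \<Rightarrow> nat \<Rightarrow> real" where
  "scalar_velocity \<mu> z \<equiv> \<lambda>i. field_deriv \<mu> z (Scalar i)"

abbreviation W_values :: "nat \<Rightarrow> jet \<Rightarrow> nat \<Rightarrow> real" where
  "W_values \<mu> z \<equiv> \<lambda>a. field_value z (WField a \<mu>)"

definition gauge_lagrangian :: "real \<Rightarrow> nat \<Rightarrow> jet \<Rightarrow> real" where
  "gauge_lagrangian g d z = (\<Sum>\<mu><d. \<Sum>\<nu><d.
          1/4 * (\<Sum>a=1..3. W_strength g z a \<mu> \<nu> * raise_indices d (W_strength g z a) \<mu> \<nu>)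
          + 1/4 * (B_strength z \<mu> \<nu> * raise_indices d (B_strength z) \<mu> \<nu>))"

lemma gauge_lagrangian_scalar_update [simp]:
  "gauge_lagrangian g d (z(Jet (Scalar i) J := t)) = gauge_lagrangian g d z"
proof -
  have "W_strength g (z(Jet (Scalar i) J := t)) = W_strength g z"
    "B_strength (z(Jet (Scalar i) J := t)) = B_strength z"
    by (auto simp: W_strength_def B_strength_def fun_eq_iff)
  then show ?thesis by (simp add: gauge_lagrangian_def)
qed

text \<open>The metric is diagonal, so raising an index gives only a sign and the scalar kinetic
  terms of different directions do not mix.\<close>

lemma lagrangian_eq_kinetic:
  "lagrangian N K g g' Y V d z =
    (\<Sum>\<mu><d. metric \<mu> \<mu> * kinetic N K g g' Y (scalars z) (scalar_velocity \<mu> z) (W_values \<mu> z)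
        (field_value z (BField \<mu>)))
    - V (scalars z) - gauge_lagrangian g d z"
proof -
  have "(\<Sum>\<mu><d.
        (\<Sum>n=1..N. Re (hermitian_product (cov_deriv g g' Y z n \<mu>)
                         (raise_index d (cov_deriv g g' Y z n) \<mu>)))
        + (\<Sum>m=1..K. 1/2 * field_deriv \<mu> z (Scalar (4 * N + m)) *
             raise_index d (\<lambda>\<nu>. field_deriv \<nu> z (Scalar (4 * N + m))) \<mu>)) =
    (\<Sum>\<mu><d. metric \<mu> \<mu> * kinetic N K g g' Y (scalars z) (scalar_velocity \<mu> z) (W_values \<mu> z)
        (field_value z (BField \<mu>)))"
    by (rule sum.cong) (simp_all add: raise_index_diag hermitian_product_scaleR Re_hermitian_product
      kinetic_def gauge_doublet_def cov_deriv_def sum_distrib_left ring_distribs mult_ac)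
  then show ?thesis
    unfolding lagrangian_def gauge_lagrangian_def by simp
qed

lemma partial_deriv_lagrangian_scalar:
  assumes "i \<in> scalar_indices N K" "polynomial_function_of (scalar_indices N K) V"
  shows "partial_deriv (Jet (Scalar i) {#}) (lagrangian N K g g' Y V d) z =
    (\<Sum>\<mu><d. metric \<mu> \<mu> * kinetic_variation N K g g' Y (scalars z) (scalar_velocity \<mu> z)
        (unit_vec i) (\<lambda>_. 0) (W_values \<mu> z) (field_value z (BField \<mu>)))
    - partial_deriv i V (scalars z)"
proof -
  have upd: "scalars (z(Jet (Scalar i) {#} := t)) = (scalars z)(i := t)" for t
    by auto
  have V: "((\<lambda>t. V ((scalars z)(i := t))) has_real_derivative partial_deriv i V (scalars z)) (at (scalars z i))"
    unfolding partial_deriv_def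
    by (intro field_differentiable_derivI polynomial_function_of_field_differentiable[OF _ assms])
      (simp add: scalar_indices_def)
  have "((\<lambda>t. lagrangian N K g g' Y V d (z(Jet (Scalar i) {#} := t))) has_real_derivative
    (\<Sum>\<mu><d. metric \<mu> \<mu> * kinetic_variation N K g g' Y (scalars z) (scalar_velocity \<mu> z)
        (unit_vec i) (\<lambda>_. 0) (W_values \<mu> z) (field_value z (BField \<mu>)))
    - partial_deriv i V (scalars z) - 0) (at (scalars z i))"
    unfolding lagrangian_eq_kinetic upd gauge_lagrangian_scalar_update
    using V kinetic_has_derivative_scalar[where \<phi> = "scalars z" and i = i]
    by (intro DERIV_diff DERIV_sum DERIV_cmult DERIV_const) simp_all
  then show ?thesis
    by (simp add: partial_deriv_def DERIV_imp_deriv)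
qed

text \<open>The velocity in direction \<mu> enters only the kinetic summand of that
  direction.\<close>

lemma partial_deriv_lagrangian_velocity:
  assumes "\<mu> < d"
  shows "partial_deriv (Jet (Scalar i) {#\<mu>#}) (lagrangian N K g g' Y V d) z =
    metric \<mu> \<mu> * kinetic_variation N K g g' Y (scalars z) (scalar_velocity \<mu> z)
        (\<lambda>_. 0) (unit_vec i) (W_values \<mu> z) (field_value z (BField \<mu>))"
proof -
  let ?k = "\<lambda>\<nu> z. metric \<nu> \<nu> * kinetic N K g g' Y (scalars z) (scalar_velocity \<nu> z) (W_values \<nu> z)
        (field_value z (BField \<nu>))"
  have upd: "scalar_velocity \<mu> (z(Jet (Scalar i) {#\<mu>#} := t)) = (scalar_velocity \<mu> z)(i := t)"
    "\<nu> \<noteq> \<mu> \<Longrightarrow> scalar_velocity \<nu> (z(Jet (Scalar i) {#\<mu>#} := t)) = scalar_velocity \<nu> z" for t \<nu>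
    by auto
  have "lagrangian N K g g' Y V d (z(Jet (Scalar i) {#\<mu>#} := t)) =
    metric \<mu> \<mu> * kinetic N K g g' Y (scalars z) ((scalar_velocity \<mu> z)(i := t)) (W_values \<mu> z)
        (field_value z (BField \<mu>))
    + ((\<Sum>\<nu>\<in>{..<d} - {\<mu>}. ?k \<nu> z) - V (scalars z) - gauge_lagrangian g d z)" for t
  proof -
    have "(\<Sum>\<nu><d. ?k \<nu> (z(Jet (Scalar i) {#\<mu>#} := t))) =
      ?k \<mu> (z(Jet (Scalar i) {#\<mu>#} := t)) + (\<Sum>\<nu>\<in>{..<d} - {\<mu>}. ?k \<nu> (z(Jet (Scalar i) {#\<mu>#} := t)))"
      using assms by (intro sum.remove) auto
    also have "(\<Sum>\<nu>\<in>{..<d} - {\<mu>}. ?k \<nu> (z(Jet (Scalar i) {#\<mu>#} := t))) = (\<Sum>\<nu>\<in>{..<d} - {\<mu>}. ?k \<nu> z)"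
      by (rule sum.cong) (simp_all add: upd del: fun_upd_apply, simp)
    finally show ?thesis
      unfolding lagrangian_eq_kinetic gauge_lagrangian_scalar_update by (simp add: upd del: fun_upd_apply) simp
  qed
  moreover have "((\<lambda>t. metric \<mu> \<mu> * kinetic N K g g' Y (scalars z) ((scalar_velocity \<mu> z)(i := t)) (W_values \<mu> z)
        (field_value z (BField \<mu>))
    + ((\<Sum>\<nu>\<in>{..<d} - {\<mu>}. ?k \<nu> z) - V (scalars z) - gauge_lagrangian g d z)) has_real_derivative
    metric \<mu> \<mu> * kinetic_variation N K g g' Y (scalars z) (scalar_velocity \<mu> z)
        (\<lambda>_. 0) (unit_vec i) (W_values \<mu> z) (field_value z (BField \<mu>)) + 0) (at (scalar_velocity \<mu> z i))"
    by (intro DERIV_add DERIV_cmult DERIV_const kinetic_has_derivative_velocity)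
  ultimately show ?thesis
    by (simp add: partial_deriv_def DERIV_imp_deriv)
qed

text \<open>The function \<open>Q\<close> of the introduction: the prolonged generator applied to
  the kinetic term of one direction.\<close>

definition kinetic_prolongation ::
    "nat \<Rightarrow> nat \<Rightarrow> real \<Rightarrow> real \<Rightarrow> real \<Rightarrow> (nat \<Rightarrow> (nat \<Rightarrow> real) \<Rightarrow> real) \<Rightarrow>
     (nat \<Rightarrow> real) \<Rightarrow> (nat \<Rightarrow> real) \<Rightarrow> (nat \<Rightarrow> real) \<Rightarrow> real \<Rightarrow> real" where
  "kinetic_prolongation N K g g' Y \<eta> \<phi> v w b =
     (\<Sum>i\<in>scalar_indices N K. \<eta> i \<phi> * kinetic_variation N K g g' Y \<phi> v (unit_vec i) (\<lambda>_. 0) w b)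
     + (\<Sum>i\<in>scalar_indices N K. \<Sum>j\<in>scalar_indices N K. v j * partial_deriv j (\<eta> i) \<phi> *
         kinetic_variation N K g g' Y \<phi> v (\<lambda>_. 0) (unit_vec i) w b)"

text \<open>The function \<open>P\<close> of the introduction: the derivative of the potential along
  the generator.\<close>

definition potential_variation ::
    "nat \<Rightarrow> nat \<Rightarrow> ((nat \<Rightarrow> real) \<Rightarrow> real) \<Rightarrow> (nat \<Rightarrow> (nat \<Rightarrow> real) \<Rightarrow> real) \<Rightarrow> (nat \<Rightarrow> real) \<Rightarrow> real" where
  "potential_variation N K V \<eta> \<phi> = (\<Sum>i\<in>scalar_indices N K. \<eta> i \<phi> * partial_deriv i V \<phi>)"

text \<open>The pure gauge terms contain no scalars and drop out; each direction contributes the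
  same function with its metric sign.\<close>

lemma prolongation_lagrangian:
  assumes "polynomial_function_of (scalar_indices N K) V"
  shows "prolongation N K d \<eta> (lagrangian N K g g' Y V d) z =
    (\<Sum>\<mu><d. metric \<mu> \<mu> * kinetic_prolongation N K g g' Y \<eta> (scalars z) (scalar_velocity \<mu> z)
        (W_values \<mu> z) (field_value z (BField \<mu>)))
    - potential_variation N K V \<eta> (scalars z)"
proof -
  let ?\<phi> = "scalars z" and ?I = "scalar_indices N K"
  let ?X = "\<lambda>\<mu> i. kinetic_variation N K g g' Y ?\<phi> (scalar_velocity \<mu> z) (unit_vec i) (\<lambda>_. 0)
    (W_values \<mu> z) (field_value z (BField \<mu>))"
  let ?Y = "\<lambda>\<mu> i. kinetic_variation N K g g' Y ?\<phi> (scalar_velocity \<mu> z) (\<lambda>_. 0) (unit_vec i)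
    (W_values \<mu> z) (field_value z (BField \<mu>))"
  have 1: "(\<Sum>i\<in>?I. \<eta> i ?\<phi> * partial_deriv (Jet (Scalar i) {#}) (lagrangian N K g g' Y V d) z) =
    (\<Sum>\<mu><d. \<Sum>i\<in>?I. metric \<mu> \<mu> * (\<eta> i ?\<phi> * ?X \<mu> i)) - potential_variation N K V \<eta> ?\<phi>"
    unfolding potential_variation_def
    by (subst sum.swap, unfold sum_subtractf[symmetric], rule sum.cong)
      (simp_all add: partial_deriv_lagrangian_scalar[OF _ assms] right_diff_distrib sum_distrib_left mult_ac)
  have 2: "(\<Sum>\<mu><d. \<Sum>i\<in>?I. \<Sum>j\<in>?I. field_deriv \<mu> z (Scalar j) * partial_deriv j (\<eta> i) ?\<phi> *
      partial_deriv (Jet (Scalar i) {#\<mu>#}) (lagrangian N K g g' Y V d) z) =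
    (\<Sum>\<mu><d. \<Sum>i\<in>?I. \<Sum>j\<in>?I. metric \<mu> \<mu> * (field_deriv \<mu> z (Scalar j) * partial_deriv j (\<eta> i) ?\<phi> * ?Y \<mu> i))"
    by (intro sum.cong) (simp_all add: partial_deriv_lagrangian_velocity mult_ac)
  show ?thesis
    unfolding prolongation_def Let_def 1 2 kinetic_prolongation_def
    by (simp add: sum_distrib_left distrib_left sum.distrib)
qed

text \<open>In a variation of the scalars alone, both factors of each inner product are linear in
  (\<open>v\<close>, \<open>w\<close>, \<open>b\<close>). In a variation of the velocities alone,
  the second factor is the doublet of \<open>u\<close>, which does not scale.\<close>

lemma kinetic_variation_scale:
  "kinetic_variation N K g g' Y \<phi> (\<lambda>i. s * v i) \<psi> (\<lambda>_. 0) (\<lambda>a. s * w a) (s * b) =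
     s\<^sup>2 * kinetic_variation N K g g' Y \<phi> v \<psi> (\<lambda>_. 0) w b"
  "kinetic_variation N K g g' Y \<phi> (\<lambda>i. s * v i) (\<lambda>_. 0) u (\<lambda>a. s * w a) (s * b) =
     s * kinetic_variation N K g g' Y \<phi> v (\<lambda>_. 0) u w b"
proof -
  show "kinetic_variation N K g g' Y \<phi> (\<lambda>i. s * v i) \<psi> (\<lambda>_. 0) (\<lambda>a. s * w a) (s * b) =
     s\<^sup>2 * kinetic_variation N K g g' Y \<phi> v \<psi> (\<lambda>_. 0) w b"
  proof -
    have zero: "gauge_doublet g g' Y \<psi> (\<lambda>_. 0) (\<lambda>a. s * w a) (s * b) n =
      s *\<^sub>R gauge_doublet g g' Y \<psi> (\<lambda>_. 0) w b n" for n
      using gauge_doublet_scale[of g g' Y \<psi> s "\<lambda>_. 0" w b n] by simp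
    show ?thesis
      unfolding kinetic_variation_def gauge_doublet_scale zero
      by (simp add: power2_eq_square sum_distrib_left mult_ac)
  qed
  show "kinetic_variation N K g g' Y \<phi> (\<lambda>i. s * v i) (\<lambda>_. 0) u (\<lambda>a. s * w a) (s * b) =
     s * kinetic_variation N K g g' Y \<phi> v (\<lambda>_. 0) u w b"
    unfolding kinetic_variation_def gauge_doublet_scale gauge_doublet_zero_scalars
    by (simp add: sum_distrib_left distrib_left mult_ac)
qed

text \<open>In the first sum the variation supplies both factors \<open>s\<close>; in the second it
  supplies one and the explicit \<open>v j\<close> the other.\<close>

lemma kinetic_prolongation_scale:
  "kinetic_prolongation N K g g' Y \<eta> \<phi> (\<lambda>i. s * v i) (\<lambda>a. s * w a) (s * b) =
     s\<^sup>2 * kinetic_prolongation N K g g' Y \<eta> \<phi> v w b"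
  unfolding kinetic_prolongation_def kinetic_variation_scale
  by (simp add: sum_distrib_left distrib_left power2_eq_square mult_ac)

section \<open>Continuity along straight lines in field space\<close>

lemma continuous_along_line:
  fixes f :: "('c \<Rightarrow> real) \<Rightarrow> 'b::topological_space"
  assumes "continuous_on UNIV f"
  shows "continuous_on A (\<lambda>t. f (\<lambda>i. \<phi> i + t * v i))"
proof (rule continuous_on_compose2[OF assms])
  show "continuous_on A (\<lambda>t i. \<phi> i + t * v i)"
    by (rule continuous_on_coordinatewise_then_product) (intro continuous_intros)
qed simp

lemma continuous_kinetic_variation_line:
  "continuous_on A (\<lambda>t. kinetic_variation N K g g' Y (\<lambda>i. \<phi> i + t * v i) v \<psi> u w b)"
proof -
  have "gauge_doublet g g' Y (\<lambda>i. \<phi> i + t * v i) v w b n =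
    gauge_doublet g g' Y \<phi> v w b n + t *\<^sub>R gauge_doublet g g' Y v (\<lambda>_. 0) w b n" for t n
    using gauge_doublet_add_scale[of g g' Y \<phi> t v v "\<lambda>_. 0" w b n] by simp
  then show ?thesis
    unfolding kinetic_variation_def by (simp only:) (intro continuous_intros)
qed

lemma scalar_generator_continuous:
  assumes "scalar_generator N K \<eta>" "i \<in> scalar_indices N K"
  shows "continuous_on UNIV (\<eta> i)" "continuous_on UNIV (partial_deriv j (\<eta> i))"
proof -
  have "smooth_function_of (scalar_indices N K) (\<eta> i)"
    using assms by (simp add: scalar_generator_def)
  then show "continuous_on UNIV (\<eta> i)" "continuous_on UNIV (partial_deriv j (\<eta> i))"
    by (rule smooth_function_of_continuous)+
qed

lemma continuous_kinetic_prolongation_line: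
  assumes "scalar_generator N K \<eta>"
  shows "continuous_on A (\<lambda>t. kinetic_prolongation N K g g' Y \<eta> (\<lambda>i. \<phi> i + t * v i) v w b)"
  unfolding kinetic_prolongation_def
proof (intro continuous_on_add continuous_on_sum continuous_on_mult continuous_on_const
    continuous_kinetic_variation_line)
  fix i assume i: "i \<in> scalar_indices N K"
  show "continuous_on A (\<lambda>t. \<eta> i (\<lambda>i. \<phi> i + t * v i))"
    by (rule continuous_along_line[OF scalar_generator_continuous(1)[OF assms i]])
  show "continuous_on A (\<lambda>t. partial_deriv j (\<eta> i) (\<lambda>i. \<phi> i + t * v i))" for j
    by (rule continuous_along_line[OF scalar_generator_continuous(2)[OF assms i]])
qed

lemma continuous_potential_variation_line:
  assumes "scalar_generator N K \<eta>" "polynomial_function_of (scalar_indices N K) V"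
  shows "continuous_on A (\<lambda>t. potential_variation N K V \<eta> (\<lambda>i. \<phi> i + t * v i))"
  unfolding potential_variation_def
proof (intro continuous_on_sum continuous_on_mult)
  fix i assume i: "i \<in> scalar_indices N K"
  show "continuous_on A (\<lambda>t. \<eta> i (\<lambda>i. \<phi> i + t * v i))"
    by (rule continuous_along_line[OF scalar_generator_continuous(1)[OF assms(1) i]])
  have "continuous_on UNIV (partial_deriv i V)"
    by (rule polynomial_function_of_continuous_partial_deriv[OF _ i assms(2)]) (simp add: scalar_indices_def)
  then show "continuous_on A (\<lambda>t. partial_deriv i V (\<lambda>i. \<phi> i + t * v i))"
    by (rule continuous_along_line)
qed

section \<open>Continuity, bounds and integrals of the bump\<close>

lemma continuous_bump_compose:
  "continuous_on UNIV (q :: real \<Rightarrow> real) \<Longrightarrow> continuous_on UNIV (\<lambda>y. q (bump d R r J y))"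
  by (rule continuous_on_compose2[of UNIV q]) (simp_all add: continuous_bump)

text \<open>Stated for an arbitrary functional \<open>F\<close> of all derivatives of the bump, so
  that it applies to the integrands below by unification.\<close>

lemma depends_only_on_bump: "depends_only_on {..<d} (\<lambda>y. F (\<lambda>J. bump d R r J y))"
  unfolding depends_only_on_def
proof (intro allI impI)
  fix y y' :: "nat \<Rightarrow> real" assume "\<forall>c\<in>{..<d}. y c = y' c"
  then have "bump d R r J y = bump d R r J y'" for J
    by (intro bump_cong) simp
  then show "F (\<lambda>J. bump d R r J y) = F (\<lambda>J. bump d R r J y')" by simp
qed

lemma bump_bounds:
  assumes "\<And>x. -1 < x \<Longrightarrow> x < 1 \<Longrightarrow> 0 \<le> poly r x \<and> poly r x \<le> 1" "y \<in> space (box_measure d)"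
  shows "0 \<le> bump d R r {#} y" "bump d R r {#} y \<le> 1"
  unfolding bump_empty using assms(1) space_box_measure[OF assms(2)]
  by (auto intro!: prod_nonneg prod_le_1)

text \<open>The square factorises, with \<open>pderiv r\<close> in direction \<mu> and
  \<open>r\<close> in the others, so the integral is a product of nonzero one-dimensional
  integrals.\<close>

lemma integral_bump_derivative_square:
  assumes "\<mu> < d" "r \<noteq> 0" "pderiv r \<noteq> 0"
  shows "integral\<^sup>L (box_measure d) (\<lambda>y. (bump d (\<lambda>_. 1) r {#\<mu>#} y)\<^sup>2) \<noteq> 0"
proof -
  let ?f = "\<lambda>\<nu>. if \<nu> = \<mu> then pderiv r else r"
  have f: "?f \<nu> \<noteq> 0" for \<nu> using assms by simp
  have "(bump d (\<lambda>_. 1) r {#\<mu>#} y)\<^sup>2 = (\<Prod>\<nu><d. (poly (?f \<nu>) (y \<nu>))\<^sup>2)" for y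
    unfolding bump_def prod_power_distrib[symmetric] by (intro arg_cong[where f = "\<lambda>x. x\<^sup>2"] prod.cong) auto
  moreover have "(\<integral>y. (\<Prod>\<nu><d. (\<lambda>x. (poly (?f \<nu>) x)\<^sup>2) (y \<nu>)) \<partial>box_measure d) =
    (\<Prod>\<nu><d. integral\<^sup>L (restrict_space lborel {-1<..<1}) (\<lambda>x. (poly (?f \<nu>) x)\<^sup>2))"
    unfolding box_measure_def
    by (rule product_sigma_finite.product_integral_prod[OF product_sigma_finite_unit_interval])
      (use integral_unit_interval_poly_pos(1)[OF f] in auto)
  ultimately show ?thesis
    using integral_unit_interval_poly_pos(2)[OF f] by simp
qed

section \<open>Characterisation of variational symmetries\<close>

text \<open>The shape of the prolonged Lagrangian on the test fields minus its value on the constant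
  fields. The lengths \<open>R\<close> enter only as explicit weights because the bumps are taken at
  unit scale.\<close>

definition test_integrand ::
    "nat \<Rightarrow> real poly \<Rightarrow> (nat \<Rightarrow> real) \<Rightarrow> ((nat \<Rightarrow> real) \<Rightarrow> real) \<Rightarrow> ((nat \<Rightarrow> real) \<Rightarrow> real) \<Rightarrow>
     (nat \<Rightarrow> real) \<Rightarrow> (nat \<Rightarrow> real) \<Rightarrow> (nat \<Rightarrow> real) \<Rightarrow> real" where
  "test_integrand d r R Q P \<phi> v y =
    (\<Sum>\<mu><d. metric \<mu> \<mu> * ((1 / R \<mu>)\<^sup>2 * ((bump d (\<lambda>_. 1) r {#\<mu>#} y)\<^sup>2 *
      Q (\<lambda>i. \<phi> i + bump d (\<lambda>_. 1) r {#} y * v i))))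
    - (P (\<lambda>i. \<phi> i + bump d (\<lambda>_. 1) r {#} y * v i) - P \<phi>)"

lemma bump_empty_unscaled: "bump d R r {#} = bump d (\<lambda>_. 1) r {#}"
  by (simp add: fun_eq_iff bump_empty)

text \<open>In direction \<mu> the velocities and gauge components are all proportional to the
  derivative of \<rho> in that direction, so homogeneity extracts its square.\<close>

lemma prolongation_test_jet:
  fixes N K :: nat and g g' Y :: real and \<eta> :: "nat \<Rightarrow> (nat \<Rightarrow> real) \<Rightarrow> real" and V
  defines "Q \<equiv> kinetic_prolongation N K g g' Y \<eta>" and "P \<equiv> potential_variation N K V \<eta>"
  assumes "polynomial_function_of (scalar_indices N K) V"
  shows "prolongation N K d \<eta> (lagrangian N K g g' Y V d) (test_jet d R r \<phi> v w b y)
    - prolongation N K d \<eta> (lagrangian N K g g' Y V d) (test_jet d R r \<phi> (\<lambda>_. 0) (\<lambda>_. 0) 0 y)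
    = test_integrand d r R (\<lambda>\<psi>. Q \<psi> v w b) P \<phi> v y"
proof -
  let ?z = "test_jet d R r \<phi> v w b y" and ?ref = "test_jet d R r \<phi> (\<lambda>_. 0) (\<lambda>_. 0) 0 y"
  let ?\<rho> = "bump d (\<lambda>_. 1) r {#} y" and ?\<sigma> = "\<lambda>\<mu>. bump d (\<lambda>_. 1) r {#\<mu>#} y"
  have sc: "scalars ?z = (\<lambda>i. \<phi> i + ?\<rho> * v i)" "scalars ?ref = \<phi>"
    by (simp_all add: test_jet_def bump_empty_unscaled[of d R] mult.commute)
  have z: "Q (scalars ?z) (scalar_velocity \<mu> ?z) (W_values \<mu> ?z) (field_value ?z (BField \<mu>)) =
    (1 / R \<mu>)\<^sup>2 * ((?\<sigma> \<mu>)\<^sup>2 * Q (\<lambda>i. \<phi> i + ?\<rho> * v i) v w b)" if "\<mu> < d" for \<mu>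
  proof -
    have "scalar_velocity \<mu> ?z = (\<lambda>i. (1 / R \<mu> * ?\<sigma> \<mu>) * v i)"
      "W_values \<mu> ?z = (\<lambda>a. (1 / R \<mu> * ?\<sigma> \<mu>) * w a)"
      "field_value ?z (BField \<mu>) = (1 / R \<mu> * ?\<sigma> \<mu>) * b"
      by (simp_all add: test_jet_def bump_single[OF that, of R] mult_ac)
    then show ?thesis
      unfolding sc by (simp only: Q_def kinetic_prolongation_scale power_mult_distrib mult.assoc)
  qed
  \<comment> \<open>Homogeneity with scaling factor 0.\<close>
  have z0: "Q (scalars ?ref) (scalar_velocity \<mu> ?ref) (W_values \<mu> ?ref) (field_value ?ref (BField \<mu>)) = 0" for \<mu>
    using kinetic_prolongation_scale[of N K g g' Y \<eta> \<phi> 0 v w b] by (simp add: test_jet_def Q_def)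
  show ?thesis
    unfolding prolongation_lagrangian[OF assms(3)] test_integrand_def Q_def[symmetric] P_def[symmetric] z0
    using z unfolding sc by simp
qed

text \<open>The bound \<open>m\<close> depends only on the order of the given divergence;
  quantifying it first leaves profile, box lengths and amplitudes free to vary afterwards.\<close>

lemma variational_symmetry_test_integral:
  fixes N K :: nat and g g' Y :: real and \<eta> :: "nat \<Rightarrow> (nat \<Rightarrow> real) \<Rightarrow> real" and V
  defines "Q \<equiv> kinetic_prolongation N K g g' Y \<eta>" and "P \<equiv> potential_variation N K V \<eta>"
  assumes poly: "polynomial_function_of (scalar_indices N K) V"
    and "variational_symmetry N K d (lagrangian N K g g' Y V d) \<eta>"
  shows "\<exists>m. \<forall>r R \<phi> v w b. [:1, 0, -1:] ^ m dvd r \<longrightarrow> (\<forall>\<mu>. R \<mu> \<noteq> 0) \<longrightarrow>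
    (\<integral>y. test_integrand d r R (\<lambda>\<psi>. Q \<psi> v w b) P \<phi> v y \<partial>box_measure d) = 0"
proof -
  obtain \<beta> where \<beta>: "\<And>\<mu>. \<mu> < d \<Longrightarrow> local_function N K d (\<beta> \<mu>)"
    "\<And>z. prolongation N K d \<eta> (lagrangian N K g g' Y V d) z = (\<Sum>\<mu><d. total_deriv \<mu> (\<beta> \<mu>) z)"
    using assms(4) unfolding variational_symmetry_def by blast
  have "\<forall>\<mu>. \<exists>S. \<mu> < d \<longrightarrow> finite S \<and> smooth_function_of S (\<beta> \<mu>)"
    using \<beta>(1) unfolding local_function_def by blast
  from choice[OF this] obtain S where S: "\<And>\<mu>. \<mu> < d \<Longrightarrow> finite (S \<mu>)"
    "\<And>\<mu>. \<mu> < d \<Longrightarrow> smooth_function_of (S \<mu>) (\<beta> \<mu>)"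
    by blast
  define ord where "ord c = (case c of Spacetime _ \<Rightarrow> 0 | Jet u J \<Rightarrow> size J)" for c
  \<comment> \<open>The sum of the orders bounds each of them; \<open>+ 2\<close> makes the
    inequality strict after the extra derivative carried by the gauge fields.\<close>
  define m where "m = (\<Sum>c\<in>(\<Union>\<mu><d. S \<mu>). ord c) + 2"
  have m: "size J + 1 < m" if "\<mu> < d" "Jet u J \<in> S \<mu>" for \<mu> u J
  proof -
    have "ord (Jet u J) \<le> (\<Sum>c\<in>(\<Union>\<mu><d. S \<mu>). ord c)"
      by (rule member_le_sum) (use that S in auto)
    then show ?thesis by (simp add: m_def ord_def)
  qed
  show ?thesis
  proof (intro exI[of _ m] allI impI)
    fix r :: "real poly" and R \<phi> v w :: "nat \<Rightarrow> real" and b :: real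
    assume r: "[:1, 0, -1:] ^ m dvd r" and R: "\<forall>\<mu>. R \<mu> \<noteq> (0::real)"
    let ?z = "\<lambda>y. test_jet d R r \<phi> v w b y" and ?ref = "\<lambda>y. test_jet d R r \<phi> (\<lambda>_. 0) (\<lambda>_. 0) 0 y"
    have "test_integrand d r R (\<lambda>\<psi>. Q \<psi> v w b) P \<phi> v y =
      (\<Sum>\<mu><d. total_deriv \<mu> (\<beta> \<mu>) (?z y) - total_deriv \<mu> (\<beta> \<mu>) (?ref y))" for y
      using prolongation_test_jet[OF poly, where g = g and g' = g' and Y = Y and \<eta> = \<eta> and d = d and R = R
          and r = r and \<phi> = \<phi> and v = v and w = w and b = b and y = y]
      by (simp add: \<beta>(2) Q_def P_def sum_subtractf)
    moreover have "(\<integral>y. (\<Sum>\<mu><d. total_deriv \<mu> (\<beta> \<mu>) (?z y) - total_deriv \<mu> (\<beta> \<mu>) (?ref y)) \<partial>box_measure d) = 0"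
    proof -
      note div = integral_total_deriv_test_jet[OF _ S _ r m, where \<phi> = \<phi> and v = v and w = w and b = b and R = R]
      have "(\<integral>y. (\<Sum>\<mu><d. total_deriv \<mu> (\<beta> \<mu>) (?z y) - total_deriv \<mu> (\<beta> \<mu>) (?ref y)) \<partial>box_measure d)
        = (\<Sum>\<mu><d. \<integral>y. total_deriv \<mu> (\<beta> \<mu>) (?z y) - total_deriv \<mu> (\<beta> \<mu>) (?ref y) \<partial>box_measure d)"
        by (rule Bochner_Integration.integral_sum) (use div(1) R in auto)
      also have "\<dots> = 0"
        by (rule sum.neutral) (use div(2) R in auto)
      finally show ?thesis .
    qed
    ultimately show "(\<integral>y. test_integrand d r R (\<lambda>\<psi>. Q \<psi> v w b) P \<phi> v y \<partial>box_measure d) = 0"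
      by simp
  qed
qed

lemma integrable_test_integrand:
  assumes "\<And>\<phi>. continuous_on UNIV (\<lambda>t. Q (\<lambda>i. \<phi> i + t * v i))"
    "\<And>\<phi>. continuous_on UNIV (\<lambda>t. P (\<lambda>i. \<phi> i + t * v i))"
  shows "integrable (box_measure d) (test_integrand d r R Q P \<phi> v)"
proof (rule integrable_box_continuous)
  show "continuous_on UNIV (test_integrand d r R Q P \<phi> v)"
    unfolding test_integrand_def
    by (intro continuous_on_diff continuous_on_sum continuous_on_mult continuous_on_power continuous_on_const
      continuous_bump continuous_bump_compose[OF assms(1)] continuous_bump_compose[OF assms(2)])
  show "depends_only_on {..<d} (test_integrand d r R Q P \<phi> v)"
    unfolding test_integrand_def by (rule depends_only_on_bump)
qed

lemma variational_symmetry_kinetic_integral: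
  fixes N K :: nat and g g' Y :: real and \<eta> :: "nat \<Rightarrow> (nat \<Rightarrow> real) \<Rightarrow> real"
  defines "Q \<equiv> kinetic_prolongation N K g g' Y \<eta>"
  assumes "d \<ge> 1" and poly: "polynomial_function_of (scalar_indices N K) V" and gen: "scalar_generator N K \<eta>"
    and "variational_symmetry N K d (lagrangian N K g g' Y V d) \<eta>"
  shows "\<exists>m. \<forall>r \<phi> v w b. [:1, 0, -1:] ^ m dvd r \<longrightarrow>
    (\<integral>y. (bump d (\<lambda>_. 1) r {#0#} y)\<^sup>2 * Q (\<lambda>i. \<phi> i + bump d (\<lambda>_. 1) r {#} y * v i) v w b \<partial>box_measure d) = 0"
proof -
  define P where "P = potential_variation N K V \<eta>"
  obtain m where m: "\<And>r R \<phi> v w b. [:1, 0, -1:] ^ m dvd r \<Longrightarrow> (\<And>\<mu>. R \<mu> \<noteq> 0) \<Longrightarrow>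
    (\<integral>y. test_integrand d r R (\<lambda>\<psi>. Q \<psi> v w b) P \<phi> v y \<partial>box_measure d) = 0"
    using variational_symmetry_test_integral[OF poly assms(5)] unfolding Q_def P_def by blast
  show ?thesis
  proof (intro exI[of _ m] allI impI)
    fix r :: "real poly" and \<phi> v w :: "nat \<Rightarrow> real" and b :: real
    assume r: "[:1, 0, -1:] ^ m dvd r"
    \<comment> \<open>Stretching the \<open>x\<^sub>0\<close>-direction by 2 changes only the weight of the \<open>(\<partial>\<^sub>0\<rho>)\<^sup>2\<close> term.\<close>
    let ?R = "\<lambda>s \<mu>. if \<mu> = 0 then s else 1 :: real"
    let ?I = "\<lambda>s. test_integrand d r (?R s) (\<lambda>\<psi>. Q \<psi> v w b) P \<phi> v"
    let ?J = "\<lambda>y. (bump d (\<lambda>_. 1) r {#0#} y)\<^sup>2 * Q (\<lambda>i. \<phi> i + bump d (\<lambda>_. 1) r {#} y * v i) v w b"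
    \<comment> \<open>\<open>3/4\<close> is \<open>1 - (1/2)^2\<close>. The other directions and the
      potential terms cancel, and the metric sign in direction 0 is \<open>+1\<close> in every
      dimension.\<close>
    have diff: "?I 1 y - ?I 2 y = 3/4 * ?J y" for y
    proof -
      have sum: "(\<Sum>\<mu><d. F \<mu>) = F 0 + (\<Sum>\<mu>\<in>{..<d} - {0}. F \<mu>)" for F :: "nat \<Rightarrow> real"
        by (rule sum.remove) (use assms(2) in auto)
      have rest: "(\<Sum>\<mu>\<in>{..<d} - {0}. metric \<mu> \<mu> * ((1 / ?R s \<mu>)\<^sup>2 * F \<mu>)) =
        (\<Sum>\<mu>\<in>{..<d} - {0}. metric \<mu> \<mu> * F \<mu>)" for s F
        by (rule sum.cong) auto
      show ?thesis
        unfolding test_integrand_def sum rest by (simp add: metric_def power2_eq_square)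
    qed
    have "(\<integral>y. 3/4 * ?J y \<partial>box_measure d) = (\<integral>y. ?I 1 y - ?I 2 y \<partial>box_measure d)"
      by (simp only: diff)
    also have "\<dots> = integral\<^sup>L (box_measure d) (?I 1) - integral\<^sup>L (box_measure d) (?I 2)"
      by (intro Bochner_Integration.integral_diff integrable_test_integrand)
        (simp_all add: Q_def P_def continuous_kinetic_prolongation_line[OF gen]
          continuous_potential_variation_line[OF gen poly])
    also have "\<dots> = 0"
    proof -
      have "integral\<^sup>L (box_measure d) (?I s) = 0" if "s \<noteq> 0" for s
        by (rule m[OF r]) (use that in simp)
      from this[of 1] this[of 2] show ?thesis by (simp only:)
    qed
    finally show "integral\<^sup>L (box_measure d) ?J = 0" by simp
  qed
qed

lemma poly_unit_bounds:
  fixes x :: real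
  assumes "-1 < x" "x < 1"
  shows "0 < poly ([:1, 0, -1:] ^ m) x" "poly ([:1, 0, -1:] ^ m) x \<le> 1"
proof -
  have "x * x < 1" using assms by (simp add: abs_square_less_1 abs_less_iff flip: power2_eq_square)
  then show "0 < poly ([:1, 0, -1:] ^ m) x" "poly ([:1, 0, -1:] ^ m) x \<le> 1"
    by (auto simp: power_le_one)
qed

text \<open>Scaling \<open>v\<close>, \<open>w\<close>, \<open>b\<close> by \<epsilon> produces a
  factor \<epsilon>^2 that cancels, while the scalars in the integrand tend to the constant \<phi>.
  Dominated convergence leaves the value at \<phi> times the nonzero integral of the squared
  derivative of \<rho>.\<close>

lemma variational_symmetry_kinetic_prolongation:
  assumes "d \<ge> 1" and poly: "polynomial_function_of (scalar_indices N K) V" and gen: "scalar_generator N K \<eta>"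
    and "variational_symmetry N K d (lagrangian N K g g' Y V d) \<eta>"
  shows "kinetic_prolongation N K g g' Y \<eta> \<phi> v w b = 0"
proof -
  let ?Q = "kinetic_prolongation N K g g' Y \<eta>"
  obtain m where m: "\<And>r \<phi> v w b. [:1, 0, -1:] ^ m dvd r \<Longrightarrow>
    (\<integral>y. (bump d (\<lambda>_. 1) r {#0#} y)\<^sup>2 * ?Q (\<lambda>i. \<phi> i + bump d (\<lambda>_. 1) r {#} y * v i) v w b \<partial>box_measure d) = 0"
    using variational_symmetry_kinetic_integral[OF assms] by blast
  \<comment> \<open>\<open>Suc m\<close> rather than \<open>m\<close> keeps \<open>r\<close>
    nonconstant also for \<open>m = 0\<close>, so that its derivative is not zero.\<close>
  define r where "r = [:1, 0, -1::real:] ^ Suc m"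
  define \<rho> \<sigma> where "\<rho> = bump d (\<lambda>_. 1) r {#}" and "\<sigma> = bump d (\<lambda>_. 1) r {#0#}"
  define q where "q t = ?Q (\<lambda>i. \<phi> i + t * v i) v w b" for t
  have q: "continuous_on A q" for A
    unfolding q_def by (rule continuous_kinetic_prolongation_line[OF gen])
  have zero: "(\<integral>y. (\<sigma> y)\<^sup>2 * q (\<epsilon> * \<rho> y) \<partial>box_measure d) = 0" if "\<epsilon> \<noteq> 0" for \<epsilon>
  proof -
    have "(\<integral>y. (\<sigma> y)\<^sup>2 * ?Q (\<lambda>i. \<phi> i + \<rho> y * (\<epsilon> * v i)) (\<lambda>i. \<epsilon> * v i) (\<lambda>a. \<epsilon> * w a) (\<epsilon> * b) \<partial>box_measure d) = 0"
      unfolding \<rho>_def \<sigma>_def by (rule m) (unfold r_def, rule le_imp_power_dvd, simp)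
    moreover have "(\<sigma> y)\<^sup>2 * ?Q (\<lambda>i. \<phi> i + \<rho> y * (\<epsilon> * v i)) (\<lambda>i. \<epsilon> * v i) (\<lambda>a. \<epsilon> * w a) (\<epsilon> * b) =
      \<epsilon>\<^sup>2 * ((\<sigma> y)\<^sup>2 * q (\<epsilon> * \<rho> y))" for y
      unfolding kinetic_prolongation_scale q_def by (simp add: mult_ac)
    ultimately show ?thesis using that by simp
  qed
  \<comment> \<open>The arguments \<epsilon> \<rho> with \<epsilon> = 1/(n+1) stay in this interval,
    so \<open>B\<close> yields the dominating function.\<close>
  obtain B where B: "\<And>t. t \<in> {-1..1} \<Longrightarrow> norm (q t) \<le> B"
    using compact_imp_bounded[OF compact_continuous_image[OF q compact_Icc[of "-1" 1]]]
    unfolding bounded_iff by blast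
  have \<rho>: "0 \<le> \<rho> y" "\<rho> y \<le> 1" if "y \<in> space (box_measure d)" for y
    unfolding \<rho>_def using poly_unit_bounds[of _ "Suc m"]
    by (auto intro!: bump_bounds[OF _ that] simp: r_def less_imp_le simp del: power_Suc)
  have int: "integrable (box_measure d) (\<lambda>y. (\<sigma> y)\<^sup>2 * q (\<epsilon> * \<rho> y))" for \<epsilon>
  proof (rule integrable_box_continuous)
    show "continuous_on UNIV (\<lambda>y. (\<sigma> y)\<^sup>2 * q (\<epsilon> * \<rho> y))"
      unfolding \<sigma>_def \<rho>_def
      by (intro continuous_on_mult continuous_on_power continuous_bump
        continuous_on_compose2[OF q[of UNIV]] continuous_on_const) simp
    show "depends_only_on {..<d} (\<lambda>y. (\<sigma> y)\<^sup>2 * q (\<epsilon> * \<rho> y))"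
      unfolding \<sigma>_def \<rho>_def by (rule depends_only_on_bump)
  qed
  have int\<sigma>: "integrable (box_measure d) (\<lambda>y. (\<sigma> y)\<^sup>2 * B)" for B
  proof (rule integrable_box_continuous)
    show "continuous_on UNIV (\<lambda>y. (\<sigma> y)\<^sup>2 * B)"
      unfolding \<sigma>_def by (intro continuous_on_mult continuous_on_power continuous_bump continuous_on_const)
    show "depends_only_on {..<d} (\<lambda>y. (\<sigma> y)\<^sup>2 * B)"
      unfolding \<sigma>_def by (rule depends_only_on_bump)
  qed
  have "(\<lambda>n. \<integral>y. (\<sigma> y)\<^sup>2 * q (1 / real (Suc n) * \<rho> y) \<partial>box_measure d) \<longlonglongrightarrow>
    (\<integral>y. (\<sigma> y)\<^sup>2 * q 0 \<partial>box_measure d)"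
  proof (rule integral_dominated_convergence[where w = "\<lambda>y. (\<sigma> y)\<^sup>2 * B"])
    show "AE y in box_measure d. (\<lambda>n. (\<sigma> y)\<^sup>2 * q (1 / real (Suc n) * \<rho> y)) \<longlonglongrightarrow> (\<sigma> y)\<^sup>2 * q 0"
    proof (rule AE_I2)
      fix y
      have "(\<lambda>n. 1 / real (Suc n) * \<rho> y) \<longlonglongrightarrow> 0"
        by (intro tendsto_mult_left_zero LIMSEQ_Suc[OF lim_1_over_n])
      then show "(\<lambda>n. (\<sigma> y)\<^sup>2 * q (1 / real (Suc n) * \<rho> y)) \<longlonglongrightarrow> (\<sigma> y)\<^sup>2 * q 0"
        by (intro tendsto_mult tendsto_const continuous_on_tendsto_compose[OF q[of UNIV]]) simp_all
    qed
    show "AE y in box_measure d. norm ((\<sigma> y)\<^sup>2 * q (1 / real (Suc n) * \<rho> y)) \<le> (\<sigma> y)\<^sup>2 * B" for n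
    proof (rule AE_I2)
      fix y assume y: "y \<in> space (box_measure d)"
      have "1 / real (Suc n) * \<rho> y \<le> 1" using \<rho>[OF y] by (intro mult_le_one) auto
      moreover have "0 \<le> 1 / real (Suc n) * \<rho> y" using \<rho>[OF y] by simp
      ultimately have "norm (q (1 / real (Suc n) * \<rho> y)) \<le> B" by (intro B) auto
      then show "norm ((\<sigma> y)\<^sup>2 * q (1 / real (Suc n) * \<rho> y)) \<le> (\<sigma> y)\<^sup>2 * B"
        unfolding norm_mult by (intro mult_mono) auto
    qed
    show "(\<lambda>y. (\<sigma> y)\<^sup>2 * q 0) \<in> borel_measurable (box_measure d)"
      using borel_measurable_integrable[OF int[of 0]] by simp
  qed (rule borel_measurable_integrable[OF int] int\<sigma>)+
  moreover have "(\<integral>y. (\<sigma> y)\<^sup>2 * q (1 / real (Suc n) * \<rho> y) \<partial>box_measure d) = 0" for n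
    by (rule zero) simp
  ultimately have "(\<integral>y. (\<sigma> y)\<^sup>2 * q 0 \<partial>box_measure d) = 0"
    by (simp add: LIMSEQ_const_iff)
  moreover have "(\<integral>y. (\<sigma> y)\<^sup>2 \<partial>box_measure d) \<noteq> 0"
    unfolding \<sigma>_def using assms(1)
    by (intro integral_bump_derivative_square) (auto simp: r_def pderiv_eq_0_iff degree_power_eq simp del: power_Suc)
  ultimately have "q 0 = 0" by simp
  then show ?thesis by (simp add: q_def)
qed

text \<open>With the kinetic part gone, the test integral compares the potential variation at \<rho>
  \<open>v\<close> with its value at 0. Profiles tending to 1 inside the box turn this, by dominated
  convergence, into the difference of the values at 0 and at \<open>v\<close> times the
  volume.\<close>

lemma variational_symmetry_potential_variation:
  assumes "d \<ge> 1" and poly: "polynomial_function_of (scalar_indices N K) V" and gen: "scalar_generator N K \<eta>"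
    and var: "variational_symmetry N K d (lagrangian N K g g' Y V d) \<eta>"
  shows "potential_variation N K V \<eta> v = potential_variation N K V \<eta> (\<lambda>_. 0)"
proof -
  let ?P = "potential_variation N K V \<eta>"
  define p where "p t = ?P (\<lambda>i. 0 + t * v i)" for t
  have p: "continuous_on A p" for A
    unfolding p_def by (rule continuous_potential_variation_line[OF gen poly])
  obtain m where m: "\<And>r R \<phi> v w b. [:1, 0, -1:] ^ m dvd r \<Longrightarrow> (\<And>\<mu>. R \<mu> \<noteq> 0) \<Longrightarrow>
    (\<integral>y. test_integrand d r R (\<lambda>\<psi>. kinetic_prolongation N K g g' Y \<eta> \<psi> v w b) ?P \<phi> v y \<partial>box_measure d) = 0"
    using variational_symmetry_test_integral[OF poly var] by blast
  define q where "q = [:1, 0, -1::real:] ^ Suc m"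
  \<comment> \<open>Vanishes to order \<open>m\<close> on the boundary, but tends to 1 at every interior point.\<close>
  define r where "r k = 1 - (1 - q) ^ k" for k
  define \<rho> where "\<rho> k = bump d (\<lambda>_. 1) (r k) {#}" for k
  have q01: "0 < poly q x" "poly q x \<le> 1" if "-1 < x" "x < 1" for x
    using poly_unit_bounds[OF that, of "Suc m"] by (auto simp: q_def simp del: power_Suc)
  have "[:1, 0, -1:] ^ m dvd r k" for k
  proof -
    have "[:1, 0, -1:] ^ m dvd q" unfolding q_def by (rule le_imp_power_dvd) simp
    \<comment> \<open>A geometric sum: \<open>1 - (1 - q)^k\<close> has the factor
      \<open>q\<close>.\<close>
    also have "q dvd r k"
      using one_diff_power_eq[of "1 - q" k] by (simp add: r_def)
    finally show ?thesis .
  qed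
  then have "(\<integral>y. test_integrand d (r k) (\<lambda>_. 1) (\<lambda>\<psi>. kinetic_prolongation N K g g' Y \<eta> \<psi> v (\<lambda>_. 0) 0) ?P (\<lambda>_. 0) v y
      \<partial>box_measure d) = 0" for k
    by (intro m) auto
  moreover have "test_integrand d (r k) (\<lambda>_. 1) (\<lambda>\<psi>. kinetic_prolongation N K g g' Y \<eta> \<psi> v (\<lambda>_. 0) 0) ?P (\<lambda>_. 0) v y
      = p 0 - p (\<rho> k y)" for k y
    unfolding test_integrand_def variational_symmetry_kinetic_prolongation[OF assms]
    by (simp add: p_def \<rho>_def)
  ultimately have zero: "(\<integral>y. p 0 - p (\<rho> k y) \<partial>box_measure d) = 0" for k by simp
  have r01: "0 \<le> poly (r k) x \<and> poly (r k) x \<le> 1" if "-1 < x" "x < 1" for k x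
    using q01[OF that] by (auto simp: r_def power_le_one)
  obtain B where B: "\<And>t. t \<in> {0..1} \<Longrightarrow> norm (p 0 - p t) \<le> B"
    using compact_imp_bounded[OF compact_continuous_image[OF continuous_on_diff[OF continuous_on_const p]
      compact_Icc[of 0 1]], of "p 0"]
    unfolding bounded_iff by blast
  have "(\<lambda>k. \<integral>y. p 0 - p (\<rho> k y) \<partial>box_measure d) \<longlonglongrightarrow> (\<integral>y. p 0 - p 1 \<partial>box_measure d)"
  proof (rule integral_dominated_convergence[where w = "\<lambda>_. B"])
    show "AE y in box_measure d. (\<lambda>k. p 0 - p (\<rho> k y)) \<longlonglongrightarrow> p 0 - p 1"
    proof (rule AE_I2)
      fix y assume y: "y \<in> space (box_measure d)"
      have "(\<lambda>k. \<Prod>\<nu><d. poly (r k) (y \<nu>)) \<longlonglongrightarrow> (\<Prod>\<nu><d. 1 - 0)"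
      proof (rule tendsto_prod)
        fix \<nu> assume "\<nu> \<in> {..<d}"
        then have "0 < poly q (y \<nu>)" "poly q (y \<nu>) \<le> 1"
          using q01[of "y \<nu>"] space_box_measure[OF y] by auto
        then have "(\<lambda>k. (1 - poly q (y \<nu>)) ^ k) \<longlonglongrightarrow> 0"
          by (intro LIMSEQ_realpow_zero) auto
        then have "(\<lambda>k. 1 - (1 - poly q (y \<nu>)) ^ k) \<longlonglongrightarrow> 1 - 0"
          by (rule tendsto_diff[OF tendsto_const])
        then show "(\<lambda>k. poly (r k) (y \<nu>)) \<longlonglongrightarrow> 1 - 0"
          by (simp add: r_def)
      qed
      then have "(\<lambda>k. \<rho> k y) \<longlonglongrightarrow> 1" by (simp add: \<rho>_def bump_empty)
      then show "(\<lambda>k. p 0 - p (\<rho> k y)) \<longlonglongrightarrow> p 0 - p 1"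
        by (intro tendsto_diff tendsto_const continuous_on_tendsto_compose[OF p[of UNIV]]) simp_all
    qed
    show "AE y in box_measure d. norm (p 0 - p (\<rho> k y)) \<le> B" for k
    proof (intro AE_I2 B)
      fix y assume "y \<in> space (box_measure d)"
      from bump_bounds[OF r01 this] show "\<rho> k y \<in> {0..1}" by (simp add: \<rho>_def)
    qed
    show "(\<lambda>y. p 0 - p (\<rho> k y)) \<in> borel_measurable (box_measure d)" for k
    proof (rule measurable_box_continuous)
      show "continuous_on UNIV (\<lambda>y. p 0 - p (\<rho> k y))"
        unfolding \<rho>_def by (intro continuous_on_diff continuous_on_const continuous_bump_compose p)
      show "depends_only_on {..<d} (\<lambda>y. p 0 - p (\<rho> k y))"
        unfolding \<rho>_def by (rule depends_only_on_bump)
    qed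
  qed (auto intro: integrable_box_const)
  then have "(\<integral>y. p 0 - p 1 \<partial>box_measure d) = 0"
    unfolding zero by (simp add: LIMSEQ_const_iff)
  \<comment> \<open>The volume of the box, as a product of one-dimensional integrals of the squared
    constant polynomial 1.\<close>
  moreover have "(\<integral>y. 1 \<partial>box_measure d) \<noteq> (0::real)"
    using product_sigma_finite.product_integral_prod[OF product_sigma_finite_unit_interval,
        where I = "{..<d}" and f = "\<lambda>_ _. 1::real"] integral_unit_interval_poly_pos[of 1]
    by (simp add: box_measure_def)
  ultimately have "p 0 = p 1" by auto
  then show ?thesis by (simp add: p_def)
qed

section \<open>Smoothness of affine functions, and the dimension-free criterion\<close>

lemma foldr_partial_deriv_affine:
  "\<exists>a' b'. foldr partial_deriv cs (\<lambda>z. a * z c0 + b) = (\<lambda>z. a' * z c0 + b')"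
proof (induction cs)
  case (Cons c cs)
  then obtain a' b' where "foldr partial_deriv cs (\<lambda>z. a * z c0 + b) = (\<lambda>z. a' * z c0 + b')" by blast
  \<comment> \<open>A partial derivative of an affine function is constant, hence affine again with
    slope 0, which closes the induction.\<close>
  moreover have "partial_deriv c (\<lambda>z. a' * z c0 + b') = (\<lambda>z. 0 * z c0 + (if c = c0 then a' else 0))"
    unfolding partial_deriv_def by (intro ext DERIV_imp_deriv) (auto intro!: derivative_eq_intros)
  ultimately show ?case
    by (intro exI[of _ 0] exI[of _ "if c = c0 then a' else 0"]) simp
qed auto

lemma smooth_function_of_affine:
  assumes "c0 \<in> S"
  shows "smooth_function_of S (\<lambda>z. a * z c0 + b)"
  unfolding smooth_function_of_def
proof (intro conjI allI)
  show "depends_only_on S (\<lambda>z. a * z c0 + b)"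
    using assms by (simp add: depends_only_on_def)
  fix cs
  obtain a' b' where eq: "foldr partial_deriv cs (\<lambda>z. a * z c0 + b) = (\<lambda>z. a' * z c0 + b')"
    using foldr_partial_deriv_affine[of cs a c0 b] by (elim exE)
  show "continuous_on UNIV (foldr partial_deriv cs (\<lambda>z. a * z c0 + b))"
    unfolding eq by (intro continuous_intros continuous_on_product_coordinates)
  show "(\<lambda>t. foldr partial_deriv cs (\<lambda>z. a * z c0 + b) (z(c := t))) field_differentiable at (z c)" for c z
    unfolding eq by (cases "c = c0") (auto intro!: derivative_intros)
qed

text \<open>Neither condition on the right mentions \<open>d\<close>, so the equivalence for
  \<open>d = 4\<close> and for \<open>d = 1\<close> yields the theorem.\<close>

lemma variational_symmetry_lagrangian_iff:
  assumes "d \<ge> 1" and poly: "polynomial_function_of (scalar_indices N K) V" and gen: "scalar_generator N K \<eta>"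
  shows "variational_symmetry N K d (lagrangian N K g g' Y V d) \<eta> \<longleftrightarrow>
    (\<forall>\<phi> v w b. kinetic_prolongation N K g g' Y \<eta> \<phi> v w b = 0) \<and>
    (\<forall>\<phi>. potential_variation N K V \<eta> \<phi> = potential_variation N K V \<eta> (\<lambda>_. 0))"
    (is "?var \<longleftrightarrow> ?Q \<and> ?P")
proof
  assume ?var
  then show "?Q \<and> ?P"
    using variational_symmetry_kinetic_prolongation[OF assms] variational_symmetry_potential_variation[OF assms]
    by blast
next
  assume "?Q \<and> ?P"
  define c where "c = potential_variation N K V \<eta> (\<lambda>_. 0)"
  \<comment> \<open>Only the component in direction 0 is nonzero, and its total derivative is
    \<open>- c\<close>. The summand \<open>+ 0\<close> fits the affine form whose smoothness is
    established above.\<close>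
  define \<beta> :: "nat \<Rightarrow> jet \<Rightarrow> real" where "\<beta> \<mu> = (\<lambda>z. (if \<mu> = 0 then - c else 0) * z (Spacetime 0) + 0)" for \<mu>
  have prol: "prolongation N K d \<eta> (lagrangian N K g g' Y V d) z = - c" for z
    unfolding prolongation_lagrangian[OF poly] using \<open>?Q \<and> ?P\<close> by (auto simp: c_def)
  have smooth: "smooth_function_of {Spacetime 0} (\<beta> \<mu>)" for \<mu>
    unfolding \<beta>_def by (rule smooth_function_of_affine) simp
  have "total_deriv \<mu> (\<beta> \<mu>) z = (if \<mu> = 0 then - c else 0)" for \<mu> z
  proof -
    have "partial_deriv (Spacetime 0) (\<beta> \<mu>) z = (if \<mu> = 0 then - c else 0)"
      unfolding partial_deriv_def \<beta>_def by (intro DERIV_imp_deriv) (auto intro!: derivative_eq_intros)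
    then show ?thesis
      using smooth by (subst total_deriv_eq_sum[of "{Spacetime 0}"]) (auto simp: smooth_function_of_def jet_shift_def)
  qed
  then have "(\<Sum>\<mu><d. total_deriv \<mu> (\<beta> \<mu>) z) = - c" for z
    using assms(1) by simp
  moreover have "local_function N K d (\<beta> \<mu>)" for \<mu>
    unfolding local_function_def using smooth assms(1)
    by (intro exI[of _ "{Spacetime 0}"]) (auto simp: jet_coords_def)
  ultimately show ?var
    unfolding variational_symmetry_def prol by (intro exI[of _ \<beta>]) auto
qed

theorem corollary1:
  fixes N K :: nat
    and g g' Y :: real
    and V :: "(nat \<Rightarrow> real) \<Rightarrow> real"
    and \<eta> :: "nat \<Rightarrow> (nat \<Rightarrow> real) \<Rightarrow> real"
  assumes "N \<ge> 1"
    and "polynomial_function_of (scalar_indices N K) V"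
    and "scalar_generator N K \<eta>"
  shows "variational_symmetry N K 4 (lagrangian N K g g' Y V 4) \<eta> \<longleftrightarrow>
         variational_symmetry N K 1 (lagrangian N K g g' Y V 1) \<eta>"
  by (simp add: variational_symmetry_lagrangian_iff[OF _ assms(2,3)])

end
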